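(* There exists $k_0$ such that for every integer $k\ge k_0$, $N_{\ge}(k)\ge \frac{9}{163}k^2$.
   Context: All graphs are finite, undirected and simple; the order of a graph is its number of vertices. For a positive integer $k$, $N_{\ge}(k)$ denotes the smallest integer $n\ge 1$ such that every graph on $n$ vertices contains an induced subgraph that is regular (all vertices have the same degree) and has order at least $k$. *)

theory Defs
  imports Complex_Main
begin

definition simple_graph :: "'a set \<Rightarrow> ('a \<Rightarrow> 'a \<Rightarrow> bool) \<Rightarrow> bool" where
  "simple_graph V E \<longleftrightarrow> finite V \<and> (\<forall>u\<in>V. \<forall>v\<in>V. E u v \<longleftrightarrow> E v u) \<and> (\<forall>v\<in>V. \<not> E v v)"

definition induced_regular :: "('a \<Rightarrow> 'a \<Rightarrow> bool) \<Rightarrow> 'a set \<Rightarrow> bool" where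
  "induced_regular E S \<longleftrightarrow> (\<exists>d. \<forall>v\<in>S. card {u\<in>S. E v u} = d)"

definition N_ge :: "nat \<Rightarrow> nat" where
  "N_ge k = (LEAST n. n \<ge> 1 \<and>
     (\<forall>E :: nat \<Rightarrow> nat \<Rightarrow> bool. simple_graph {0..<n} E \<longrightarrow>
        (\<exists>S\<subseteq>{0..<n}. induced_regular E S \<and> card S \<ge> k)))"

end

theory Submission
  imports Defs "HOL-Probability.Distributions" "HOL-Library.Ramsey" "HOL-Real_Asymp.Real_Asymp"
begin

text \<open>
  Give the vertices \<open>i < n\<close> real weights \<open>a\<^sub>i\<close> and let \<open>{i, j}\<close> be an edge with odds \<open>exp (a\<^sub>i + a\<^sub>j)\<close>,
  independently. The probability of a graph then depends only on its degrees. For an \<open>m\<close>-set \<open>S\<close> and a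
  degree \<open>d\<close>, comparison with the model of constant weight \<open>\<theta>\<close>, where \<open>\<theta>\<close> is tuned to \<open>d\<close>, shows that
  \<open>S\<close> induces a \<open>d\<close>-regular graph with probability at most
  \<open>(\<Prod>i<m. b\<^sub>i) * (\<Prod>i\<in>S. exp (- (m - 2) (a\<^sub>i - \<theta>)\<^sup>2 / 16))\<close>. Here \<open>b\<^sub>i\<close>, about \<open>2 cosh \<theta> / sqrt (2 \<pi> i)\<close>,
  is the largest point probability of the binomial distribution on \<open>i\<close> trials, and the Gaussian factor
  penalises sets \<open>S\<close> whose weights are spread out.

  Summing over all \<open>m\<close>-sets gives at most \<open>(\<Prod>i<m. b\<^sub>i) * G ^ m / m!\<close>, where \<open>G\<close> is the sum of the
  Gaussian factors over all \<open>n\<close> vertices. If the weights have density proportional to \<open>1 / cosh a\<close> on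
  \<open>|a| \<le> arsinh 1\<close>, then \<open>G\<close> is about \<open>8 n / (cosh \<theta> sqrt (\<pi> m))\<close>, and for
  \<open>n \<le> 9 m\<^sup>2 / 163\<close> the bound is roughly the \<open>m\<close>-th power of
  \<open>72 sqrt 2 e powr (3/2) / (163 \<pi>) < 0.9\<close>. This is summable over all \<open>d \<le> m\<close> and \<open>m \<ge> k\<close>, with sum
  less than \<open>1\<close> for large \<open>k\<close>.
\<close>

section \<open>Edge sets with prescribed degrees\<close>

definition pairs :: "'a set \<Rightarrow> 'a set set" where
  "pairs V = {e. e \<subseteq> V \<and> card e = 2}"

definition degree_in :: "'a set set \<Rightarrow> 'a \<Rightarrow> nat" where
  "degree_in H v = card {e \<in> H. v \<in> e}"

lemma finite_pairs [simp]: "finite V \<Longrightarrow> finite (pairs V)"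
  by (rule finite_subset[of _ "Pow V"]) (auto simp: pairs_def)

lemma pairs_mono: "S \<subseteq> V \<Longrightarrow> pairs S \<subseteq> pairs V"
  by (auto simp: pairs_def)

lemma card_pairs: "finite V \<Longrightarrow> card (pairs V) = card V choose 2"
  unfolding pairs_def by (rule n_subsets)

lemma pairs_insert:
  assumes "v \<notin> V"
  shows "pairs (insert v V) = pairs V \<union> (\<lambda>u. {v, u}) ` V"
proof (intro equalityI subsetI)
  fix e assume "e \<in> pairs (insert v V)"
  then have e: "e \<subseteq> insert v V" "card e = 2" by (auto simp: pairs_def)
  then obtain a b where "e = {a, b}" "a \<noteq> b" by (auto simp: card_2_iff)
  then show "e \<in> pairs V \<union> (\<lambda>u. {v, u}) ` V"
    using e by (cases "a = v"; cases "b = v") (auto simp: pairs_def insert_commute)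
next
  fix e assume "e \<in> pairs V \<union> (\<lambda>u. {v, u}) ` V"
  then show "e \<in> pairs (insert v V)"
    using assms by (auto simp: pairs_def card_2_iff)
qed

lemma inj_on_edge_to: "v \<notin> V \<Longrightarrow> inj_on (\<lambda>u. {v, u}) V"
  by (auto simp: inj_on_def doubleton_eq_iff)

lemma sum_pairs_insert:
  assumes "finite V" "v \<notin> V"
  shows "(\<Sum>e\<in>pairs (insert v V). f e) = (\<Sum>e\<in>pairs V. f e) + (\<Sum>u\<in>V. f {v, u})"
proof -
  have "pairs V \<inter> (\<lambda>u. {v, u}) ` V = {}" using assms by (auto simp: pairs_def)
  then show ?thesis
    using assms by (simp add: pairs_insert sum.union_disjoint sum.reindex[OF inj_on_edge_to])
qed

lemma pairs_empty [simp]: "pairs {} = {}"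
  by (auto simp: pairs_def)

lemma sum_edge_to:
  fixes f :: "'a \<Rightarrow> 'b::comm_monoid_add"
  assumes "u \<in> V" "v \<notin> V"
  shows "(\<Sum>i\<in>{v, u}. f i) = f v + f u"
  using assms by (subst sum.insert) auto

lemma sum_pairs_vertices:
  fixes f :: "'a \<Rightarrow> real"
  assumes "finite V"
  shows "(\<Sum>e\<in>pairs V. \<Sum>i\<in>e. f i) = (real (card V) - 1) * (\<Sum>i\<in>V. f i)"
  using assms
proof induction
  case (insert v V)
  have "(\<Sum>u\<in>V. \<Sum>i\<in>{v, u}. f i) = (\<Sum>u\<in>V. f v + f u)"
    using insert by (intro sum.cong sum_edge_to) auto
  then show ?case using insert
    by (simp add: sum_pairs_insert sum.distrib algebra_simps)
qed simp

text \<open>Each square occurs in \<open>card V - 1\<close> pairs and each mixed product in one,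
  doubled; completing the square of the full sum uses up one copy of the squares. The remaining
  factor \<open>card V - 2\<close> becomes the strength of the Gaussian penalty.\<close>

lemma sum_pairs_square:
  fixes f :: "'a \<Rightarrow> real"
  assumes "finite V"
  shows "(\<Sum>e\<in>pairs V. (\<Sum>i\<in>e. f i)^2) = (real (card V) - 2) * (\<Sum>i\<in>V. (f i)^2) + (\<Sum>i\<in>V. f i)^2"
  using assms
proof induction
  case (insert v V)
  have "(\<Sum>u\<in>V. (\<Sum>i\<in>{v, u}. f i)^2) = (\<Sum>u\<in>V. (f v + f u)^2)"
    using insert sum_edge_to[of _ V v f] by (intro sum.cong) auto
  also have "\<dots> = real (card V) * (f v)^2 + 2 * f v * (\<Sum>u\<in>V. f u) + (\<Sum>u\<in>V. (f u)^2)"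
    by (simp add: power2_sum sum.distrib sum_distrib_left mult.assoc)
  finally show ?case using insert
    by (simp add: sum_pairs_insert algebra_simps power2_eq_square)
qed simp

text \<open>Double counting of incidences, a weighted handshake lemma. It is the reason why the
  weight of a graph depends only on its degrees.\<close>

lemma sum_edges_vertices:
  fixes f :: "'a \<Rightarrow> real"
  assumes "finite V" "H \<subseteq> pairs V"
  shows "(\<Sum>e\<in>H. \<Sum>i\<in>e. f i) = (\<Sum>v\<in>V. f v * real (degree_in H v))"
proof -
  have fH: "finite H" using assms finite_subset finite_pairs by blast
  have "(\<Sum>e\<in>H. \<Sum>i\<in>e. f i) = (\<Sum>e\<in>H. \<Sum>i\<in>V. if i \<in> e then f i else 0)"
  proof (rule sum.cong[OF refl])
    fix e assume "e \<in> H"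
    then have "V \<inter> e = e" using assms by (auto simp: pairs_def)
    then show "(\<Sum>i\<in>e. f i) = (\<Sum>i\<in>V. if i \<in> e then f i else 0)"
      using assms sum.inter_restrict[of V f e] by simp
  qed
  also have "\<dots> = (\<Sum>i\<in>V. \<Sum>e\<in>H. if i \<in> e then f i else 0)" by (rule sum.swap)
  also have "\<dots> = (\<Sum>v\<in>V. f v * real (degree_in H v))"
  proof (intro sum.cong refl)
    fix i assume "i \<in> V"
    show "(\<Sum>e\<in>H. if i \<in> e then f i else 0) = f i * real (degree_in H i)"
      unfolding sum.inter_filter[OF fH, symmetric] by (simp add: degree_in_def)
  qed
  finally show ?thesis .
qed

definition with_degrees :: "'a set \<Rightarrow> ('a \<Rightarrow> nat) \<Rightarrow> 'a set set set" where
  "with_degrees V t = {H. H \<subseteq> pairs V \<and> (\<forall>v\<in>V. degree_in H v = t v)}"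

lemma finite_with_degrees: "finite V \<Longrightarrow> finite (with_degrees V t)"
  by (rule finite_subset[of _ "Pow (pairs V)"]) (auto simp: with_degrees_def)

text \<open>\<open>N\<close> is the neighbourhood of \<open>v\<close>, and \<open>H'\<close> is what
  remains after deleting \<open>v\<close>. For \<open>u \<in> N\<close> the edge to \<open>v\<close>
  forces \<open>t u\<close> to be positive, so \<open>t u - 1\<close> does not truncate.\<close>

lemma with_degrees_insert_split:
  assumes "finite V" "v \<notin> V" "H \<in> with_degrees (insert v V) t"
  obtains N H' where "N \<subseteq> V" "card N = t v" "H' \<in> with_degrees V (\<lambda>u. if u \<in> N then t u - 1 else t u)"
    "H = H' \<union> (\<lambda>u. {v, u}) ` N"
proof -
  define N where "N = {u \<in> V. {v, u} \<in> H}"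
  define H' where "H' = H \<inter> pairs V"
  have fN: "finite N" "N \<subseteq> V" "v \<notin> N" using assms by (auto simp: N_def)
  have H: "H \<subseteq> pairs V \<union> (\<lambda>u. {v, u}) ` V"
    using assms(3) pairs_insert[OF assms(2)] by (auto simp: with_degrees_def)
  then have eq: "H = H' \<union> (\<lambda>u. {v, u}) ` N" by (auto simp: H'_def N_def)
  have fH': "finite H'" using assms by (simp add: H'_def)
  have "{e \<in> H. v \<in> e} = (\<lambda>u. {v, u}) ` N"
    using eq assms(2) by (auto simp: H'_def pairs_def)
  then have "degree_in H v = card N"
    using inj_on_edge_to[OF fN(3)] by (simp add: degree_in_def card_image)
  then have 1: "card N = t v" using assms by (simp add: with_degrees_def)
  have "degree_in H' u = (if u \<in> N then t u - 1 else t u)" if u: "u \<in> V" for u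
  proof -
    have t: "degree_in H u = t u" using assms u by (simp add: with_degrees_def)
    have uv: "u \<noteq> v" using u assms by auto
    show ?thesis
    proof (cases "u \<in> N")
      case True
      have "{e \<in> H. u \<in> e} = insert {v, u} {e \<in> H'. u \<in> e}"
        using eq True uv by auto
      moreover have "{v, u} \<notin> H'" using assms(2) by (auto simp: H'_def pairs_def)
      ultimately have "degree_in H u = Suc (degree_in H' u)"
        using fH' by (simp add: degree_in_def)
      with t True show ?thesis by simp
    next
      case False
      have "{e \<in> H. u \<in> e} = {e \<in> H'. u \<in> e}" using eq False uv by auto
      with t False show ?thesis by (simp add: degree_in_def)
    qed
  qed
  then have "H' \<in> with_degrees V (\<lambda>u. if u \<in> N then t u - 1 else t u)"
    by (auto simp: with_degrees_def H'_def)
  with that fN 1 eq show ?thesis by blast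
qed

text \<open>Vertices are exposed one at a time: the last of \<open>i + 1\<close> vertices chooses its prescribed number
  of neighbours among the other \<open>i\<close>, and this fixes the degrees required of the rest.\<close>

lemma sum_with_degrees_le:
  fixes x :: real
  assumes "finite V" "0 \<le> x" and b: "\<And>i j. real (i choose j) * x^j \<le> b i"
  shows "(\<Sum>H\<in>with_degrees V t. x^card H) \<le> (\<Prod>i<card V. b i)"
  using assms(1)
proof (induction arbitrary: t)
  case empty
  have "with_degrees {} t = {{}}" by (auto simp: with_degrees_def)
  then show ?case by simp
next
  case (insert v V)
  define g :: "'a set \<times> 'a set set \<Rightarrow> 'a set set" where "g = (\<lambda>(N, H'). H' \<union> (\<lambda>u. {v, u}) ` N)"
  define \<N> where "\<N> = {N. N \<subseteq> V \<and> card N = t v}"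
  define t' where "t' N = (\<lambda>u. if u \<in> N then t u - 1 else t u)" for N
  define D where "D = Sigma \<N> (\<lambda>N. with_degrees V (t' N))"
  have fN: "finite \<N>" using insert by (auto simp: \<N>_def)
  have fD: "finite D" unfolding D_def using fN insert by (intro finite_SigmaI finite_with_degrees) auto
  have b0: "0 \<le> b i" for i using b[of i 0] by simp
  have rec: "fst q = {u \<in> V. {v, u} \<in> g q}" "snd q = g q \<inter> pairs V" if "q \<in> D" for q
    using that insert(2)
    by (auto simp: D_def \<N>_def with_degrees_def g_def pairs_def doubleton_eq_iff)
  have inj: "inj_on g D"
    by (rule inj_onI) (metis rec prod_eqI)
  have crd: "card (g q) = card (fst q) + card (snd q)" if "q \<in> D" for q
  proof -
    obtain N H' where q: "q = (N, H')" by force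
    have N: "N \<subseteq> V" "H' \<subseteq> pairs V" using that q by (auto simp: D_def \<N>_def with_degrees_def)
    then have "finite N" "finite H'" using insert(1) finite_subset finite_pairs by blast+
    moreover have "H' \<inter> (\<lambda>u. {v, u}) ` N = {}" using N insert(2) by (auto simp: pairs_def)
    ultimately have "card (g q) = card H' + card ((\<lambda>u. {v, u}) ` N)"
      unfolding q g_def by (simp add: card_Un_disjoint)
    also have "card ((\<lambda>u. {v, u}) ` N) = card N"
      by (rule card_image) (use inj_on_subset[OF inj_on_edge_to[OF insert(2)] N(1)] in simp)
    finally show ?thesis by (simp add: q)
  qed
  \<comment> \<open>In general this is only an inclusion: if \<open>t u = 0\<close> for some
    \<open>u \<in> N\<close>, truncation keeps the requirement at 0 and the union has degree 1 at
    \<open>u\<close>. Extra terms are harmless for an upper bound.\<close>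
  have "with_degrees (insert v V) t \<subseteq> g ` D"
  proof
    fix H assume H: "H \<in> with_degrees (insert v V) t"
    obtain N H' where "N \<subseteq> V" "card N = t v" "H' \<in> with_degrees V (t' N)"
      "H = H' \<union> (\<lambda>u. {v, u}) ` N"
      by (rule with_degrees_insert_split[OF insert(1,2) H, folded t'_def])
    then show "H \<in> g ` D" by (intro image_eqI[of _ _ "(N, H')"]) (auto simp: D_def g_def \<N>_def)
  qed
  then have "(\<Sum>H\<in>with_degrees (insert v V) t. x^card H) \<le> (\<Sum>H\<in>g ` D. x^card H)"
    using fD assms(2) by (intro sum_mono2) auto
  also have "\<dots> = (\<Sum>q\<in>D. x^(card (fst q) + card (snd q)))"
    using crd by (simp add: sum.reindex[OF inj])
  also have "\<dots> = (\<Sum>N\<in>\<N>. \<Sum>H'\<in>with_degrees V (t' N). x^(card N + card H'))"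
    unfolding D_def using fN insert(1)
    by (subst sum.Sigma) (auto simp: finite_with_degrees split_def)
  also have "\<dots> = (\<Sum>N\<in>\<N>. x^t v * (\<Sum>H'\<in>with_degrees V (t' N). x^card H'))"
    by (intro sum.cong) (auto simp: \<N>_def power_add sum_distrib_left)
  also have "\<dots> \<le> (\<Sum>N\<in>\<N>. x^t v * (\<Prod>i<card V. b i))"
    using insert assms(2) by (intro sum_mono mult_left_mono) auto
  also have "\<dots> = (real (card V choose t v) * x^t v) * (\<Prod>i<card V. b i)"
    using n_subsets[OF insert(1), of "t v"] by (simp add: \<N>_def)
  also have "\<dots> \<le> b (card V) * (\<Prod>i<card V. b i)"
    using b b0 by (intro mult_right_mono prod_nonneg) auto
  finally show ?case using insert by (simp add: mult.commute)
qed

section \<open>Union bound for random edge sets, and symmetric sums over subsets\<close>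

lemma sum_subsets_marginal:
  fixes w :: "'e \<Rightarrow> real"
  assumes "finite P" "Q \<subseteq> P" "\<E> \<subseteq> Pow Q"
  shows "(\<Sum>F | F \<subseteq> P \<and> F \<inter> Q \<in> \<E>. \<Prod>e\<in>F. w e) = (\<Sum>H\<in>\<E>. \<Prod>e\<in>H. w e) * (\<Prod>e\<in>P - Q. 1 + w e)"
proof -
  have fin: "finite Q" "finite (P - Q)" "finite \<E>"
    using assms finite_subset[of Q P] finite_subset[of \<E> "Pow Q"] by auto
  have "(\<Prod>e\<in>P - Q. 1 + w e) = (\<Sum>K\<in>Pow (P - Q). \<Prod>e\<in>K. w e)"
    using prod_add[OF fin(2), of w "\<lambda>_. 1"] by (simp add: add.commute)
  then have "(\<Sum>H\<in>\<E>. \<Prod>e\<in>H. w e) * (\<Prod>e\<in>P - Q. 1 + w e) =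
      (\<Sum>(H, K)\<in>\<E> \<times> Pow (P - Q). (\<Prod>e\<in>H. w e) * (\<Prod>e\<in>K. w e))"
    by (simp add: sum_product sum.cartesian_product)
  also have "\<dots> = (\<Sum>F | F \<subseteq> P \<and> F \<inter> Q \<in> \<E>. \<Prod>e\<in>F. w e)"
  proof (rule sum.reindex_bij_witness[where i = "\<lambda>F. (F \<inter> Q, F - Q)" and j = "\<lambda>(H, K). H \<union> K"])
    fix q assume "q \<in> \<E> \<times> Pow (P - Q)"
    then obtain H K where q: "q = (H, K)" "H \<in> \<E>" "K \<subseteq> P - Q" by auto
    have HQ: "H \<subseteq> Q" using q assms by auto
    then have e: "(H \<union> K) \<inter> Q = H" "(H \<union> K) - Q = K" using q by auto
    show "((case q of (H, K) \<Rightarrow> H \<union> K) \<inter> Q, (case q of (H, K) \<Rightarrow> H \<union> K) - Q) = q"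
      using e q by simp
    show "(case q of (H, K) \<Rightarrow> H \<union> K) \<in> {F. F \<subseteq> P \<and> F \<inter> Q \<in> \<E>}"
      using e q HQ assms(2) by auto
    have "(\<Prod>e\<in>H \<union> K. w e) = (\<Prod>e\<in>H. w e) * (\<Prod>e\<in>K. w e)"
      using HQ q fin by (intro prod.union_disjoint) (auto intro: finite_subset)
    then show "(\<Prod>e\<in>(case q of (H, K) \<Rightarrow> H \<union> K). w e) = (case q of (H, K) \<Rightarrow> (\<Prod>e\<in>H. w e) * (\<Prod>e\<in>K. w e))"
      using q by simp
  qed auto
  finally show ?thesis by simp
qed

lemma sum_UNION_le:
  fixes f :: "'b \<Rightarrow> real"
  assumes "finite I" "\<And>i. i \<in> I \<Longrightarrow> finite (A i)" "\<And>i x. i \<in> I \<Longrightarrow> x \<in> A i \<Longrightarrow> f x \<ge> 0"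
  shows "(\<Sum>x\<in>(\<Union>i\<in>I. A i). f x) \<le> (\<Sum>i\<in>I. \<Sum>x\<in>A i. f x)"
  using assms
proof (induction I)
  case (insert j I)
  have "(\<Sum>x\<in>A j \<union> (\<Union>i\<in>I. A i). f x) \<le> (\<Sum>x\<in>A j. f x) + (\<Sum>x\<in>(\<Union>i\<in>I. A i). f x)"
    using insert by (subst sum_Un) (auto intro!: sum_nonneg)
  then show ?case using insert by fastforce
qed simp

text \<open>Union bound in unnormalised form: \<open>F\<close> has weight
  \<open>\<Prod>e\<in>F. w e\<close>, and all weights add up to
  \<open>\<Prod>e\<in>P. 1 + w e\<close>. By \<open>sum_subsets_marginal\<close> each quotient is
  the probability of one event when every \<open>e\<close> is present independently with odds
  \<open>w e\<close>. If the events covered \<open>Pow P\<close>, the total weight would be smaller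
  than itself.\<close>

lemma exists_avoiding_events:
  fixes w :: "'e \<Rightarrow> real"
  assumes "finite P" and w: "\<And>e. e \<in> P \<Longrightarrow> w e > 0"
    and I: "finite I" "\<And>i. i \<in> I \<Longrightarrow> Q i \<subseteq> P" "\<And>i. i \<in> I \<Longrightarrow> \<E> i \<subseteq> Pow (Q i)"
    and less: "(\<Sum>i\<in>I. (\<Sum>H\<in>\<E> i. \<Prod>e\<in>H. w e) / (\<Prod>e\<in>Q i. 1 + w e)) < 1"
  shows "\<exists>F\<subseteq>P. \<forall>i\<in>I. F \<inter> Q i \<notin> \<E> i"
proof (rule ccontr)
  assume "\<not> ?thesis"
  then have cover: "Pow P \<subseteq> (\<Union>i\<in>I. {F. F \<subseteq> P \<and> F \<inter> Q i \<in> \<E> i})" by blast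
  define T where "T = (\<Prod>e\<in>P. 1 + w e)"
  have T: "T > 0" unfolding T_def using w by (intro prod_pos) (simp add: add_pos_pos)
  have wF: "(\<Prod>e\<in>F. w e) \<ge> 0" if "F \<subseteq> P" for F
    using that w by (intro prod_nonneg) (auto intro: less_imp_le)
  have "T = (\<Sum>F\<in>Pow P. \<Prod>e\<in>F. w e)"
    unfolding T_def using prod_add[OF assms(1), of w "\<lambda>_. 1"] by (simp add: add.commute)
  also have "\<dots> \<le> (\<Sum>F\<in>(\<Union>i\<in>I. {F. F \<subseteq> P \<and> F \<inter> Q i \<in> \<E> i}). \<Prod>e\<in>F. w e)"
    using cover I(1) assms(1) wF by (intro sum_mono2) auto
  also have "\<dots> \<le> (\<Sum>i\<in>I. \<Sum>F | F \<subseteq> P \<and> F \<inter> Q i \<in> \<E> i. \<Prod>e\<in>F. w e)"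
    using I(1) assms(1) wF by (intro sum_UNION_le) auto
  also have "\<dots> = (\<Sum>i\<in>I. T * ((\<Sum>H\<in>\<E> i. \<Prod>e\<in>H. w e) / (\<Prod>e\<in>Q i. 1 + w e)))"
  proof (intro sum.cong refl)
    fix i assume i: "i \<in> I"
    have "T = (\<Prod>e\<in>P - Q i. 1 + w e) * (\<Prod>e\<in>Q i. 1 + w e)"
      unfolding T_def using prod.subset_diff[OF I(2)[OF i] assms(1)] .
    moreover have "(\<Prod>e\<in>Q i. 1 + w e) > 0"
      using w I(2)[OF i] by (intro prod_pos) (auto simp: subset_iff add_pos_pos)
    ultimately show "(\<Sum>F | F \<subseteq> P \<and> F \<inter> Q i \<in> \<E> i. \<Prod>e\<in>F. w e) =
        T * ((\<Sum>H\<in>\<E> i. \<Prod>e\<in>H. w e) / (\<Prod>e\<in>Q i. 1 + w e))"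
      by (simp add: sum_subsets_marginal[OF assms(1) I(2)[OF i] I(3)[OF i]])
  qed
  also have "\<dots> = T * (\<Sum>i\<in>I. (\<Sum>H\<in>\<E> i. \<Prod>e\<in>H. w e) / (\<Prod>e\<in>Q i. 1 + w e))"
    by (simp add: sum_distrib_left)
  also have "\<dots> < T * 1" using T less by (intro mult_strict_left_mono)
  finally show False by simp
qed

text \<open>Bounds an elementary symmetric polynomial by a power of the sum. Splitting by membership
  of the new element \<open>v\<close> produces two of the nonnegative terms in the binomial
  expansion of \<open>(s + w v)^m\<close>.\<close>

lemma sum_prod_subsets_le:
  fixes w :: "'a \<Rightarrow> real"
  assumes "finite V" "\<And>v. v \<in> V \<Longrightarrow> w v \<ge> 0"
  shows "(\<Sum>S | S \<subseteq> V \<and> card S = m. \<Prod>i\<in>S. w i) \<le> (\<Sum>i\<in>V. w i)^m / fact m"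
  using assms
proof (induction arbitrary: m)
  case empty
  have eq: "{S. S \<subseteq> {} \<and> card S = m} = (if m = 0 then {{}} else {})" by auto
  show ?case unfolding eq by simp
next
  case (insert v V)
  define s where "s = (\<Sum>i\<in>V. w i)"
  have s: "s \<ge> 0" "w v \<ge> 0" using insert by (auto simp: s_def intro: sum_nonneg)
  show ?case
  proof (cases m)
    case 0
    have "{S. S \<subseteq> insert v V \<and> card S = 0} = {{}}"
      using insert(1) by (auto simp: card_eq_0_iff dest: finite_subset)
    then show ?thesis using 0 by simp
  next
    case (Suc k)
    let ?A = "\<lambda>j. {S. S \<subseteq> V \<and> card S = j}"
    have fA: "finite (?A j)" for j using insert(1) by simp
    have cI: "card (insert v S) = Suc (card S)" if "S \<subseteq> V" for S
      using that insert(1,2) by (metis card_insert_disjoint finite_subset subset_iff)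
    have eq: "{S. S \<subseteq> insert v V \<and> card S = Suc k} = ?A (Suc k) \<union> insert v ` ?A k"
    proof (intro equalityI subsetI)
      fix S assume S: "S \<in> {S. S \<subseteq> insert v V \<and> card S = Suc k}"
      show "S \<in> ?A (Suc k) \<union> insert v ` ?A k"
      proof (cases "v \<in> S")
        case True
        then have "S = insert v (S - {v})" "S - {v} \<subseteq> V" using S by auto
        moreover have "card (S - {v}) = k" using S True by simp
        ultimately show ?thesis by blast
      qed (use S in auto)
    qed (use cI in auto)
    have inj: "inj_on (insert v) (?A k)" using insert(2) by (auto simp: inj_on_def)
    have "(\<Sum>S | S \<subseteq> insert v V \<and> card S = m. \<Prod>i\<in>S. w i) =
        (\<Sum>S\<in>?A (Suc k). \<Prod>i\<in>S. w i) + (\<Sum>S\<in>insert v ` ?A k. \<Prod>i\<in>S. w i)"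
      unfolding Suc eq using fA insert(2) by (intro sum.union_disjoint) auto
    also have "(\<Sum>S\<in>insert v ` ?A k. \<Prod>i\<in>S. w i) = (\<Sum>S\<in>?A k. w v * (\<Prod>i\<in>S. w i))"
      unfolding sum.reindex[OF inj] using insert(1,2)
      by (intro sum.cong) (auto simp: subset_iff prod.insert_if finite_subset)
    also have "\<dots> = w v * (\<Sum>S\<in>?A k. \<Prod>i\<in>S. w i)" by (simp add: sum_distrib_left)
    also have "(\<Sum>S\<in>?A (Suc k). \<Prod>i\<in>S. w i) + \<dots> \<le> s^Suc k / fact (Suc k) + w v * (s^k / fact k)"
      unfolding s_def using insert s by (intro add_mono mult_left_mono insert.IH) auto
    also have "w v * (s^k / fact k) = real (Suc k) * (s^k * w v) / fact (Suc k)"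
      by (simp del: of_nat_Suc)
    also have "s^Suc k / fact (Suc k) + \<dots> = (s^Suc k + real (Suc k) * (s^k * w v)) / fact (Suc k)"
      by (rule add_divide_distrib[symmetric])
    also have "\<dots> \<le> (s + w v)^Suc k / fact (Suc k)"
    proof (rule divide_right_mono)
      show "s^Suc k + real (Suc k) * (s^k * w v) \<le> (s + w v)^Suc k"
      proof -
        have "(\<Sum>j\<in>{k, Suc k}. real (Suc k choose j) * s^j * w v^(Suc k - j)) \<le>
            (\<Sum>j\<le>Suc k. real (Suc k choose j) * s^j * w v^(Suc k - j))"
          using s by (intro sum_mono2) auto
        also have "\<dots> = (s + w v)^Suc k" by (simp only: binomial_ring)
        finally show ?thesis by (simp add: algebra_simps)
      qed
    qed simp
    finally show ?thesis using Suc insert by (simp add: s_def add.commute)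
  qed
qed

section \<open>Quantitative convexity of \<open>ln (1 + exp x)\<close> on the range of the
  weights\<close>

lemma cosh_square_le_two:
  fixes z :: real
  assumes "\<bar>z\<bar> \<le> arsinh 1"
  shows "cosh z ^ 2 \<le> 2"
proof -
  have "sinh z \<le> sinh (arsinh 1)" "sinh (- arsinh 1) \<le> sinh z"
    using assms by (simp_all del: sinh_arsinh_real sinh_minus)
  then have "\<bar>sinh z\<bar> \<le> 1" by simp
  then have "sinh z ^ 2 \<le> 1" using abs_le_square_iff[of "sinh z" 1] by simp
  then show ?thesis by (simp add: cosh_square_eq)
qed

text \<open>The left side is the second derivative of \<open>ln (1 + exp x)\<close> and also the
  Bernoulli variance \<open>p * (1 - p)\<close> for odds \<open>exp x\<close>. Both readings are
  needed: the first for the Gaussian factor, the second for the binomial bound.\<close>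

lemma logistic_variance: "exp x / (1 + exp x)^2 = 1 / (4 * cosh (x / 2)^2)" for x :: real
proof -
  define E where "E = exp (x / 2)"
  have E: "E > 0" "exp x = E^2" by (simp_all add: E_def exp_double[symmetric])
  have "4 * cosh (x / 2)^2 = (E + 1 / E)^2"
    by (simp add: cosh_def E_def exp_minus power2_eq_square field_simps)
  also have "E + 1 / E = (1 + E^2) / E" using E by (simp add: field_simps power2_eq_square)
  finally show ?thesis using E(1) by (simp add: E(2) power_divide)
qed

text \<open>On this range the second derivative of \<open>ln (1 + exp z)\<close> is at least 1/8,
  since \<open>4 * cosh (z / 2)^2\<close> reaches 8 only at the endpoints. Hence subtracting
  \<open>(z - y)^2 / 16\<close> leaves a convex function, which lies above its tangent at
  \<open>y\<close>.\<close>

lemma one_plus_exp_above_gaussian_tangent: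
  fixes x y :: real
  assumes "\<bar>x\<bar> \<le> 2 * arsinh 1" "\<bar>y\<bar> \<le> 2 * arsinh 1"
  shows "(1 + exp y) * exp (exp y / (1 + exp y) * (x - y) + (x - y)^2 / 16) \<le> 1 + exp x"
proof -
  define I where "I = {- (2 * arsinh 1)..(2 * arsinh 1 :: real)}"
  define f :: "real \<Rightarrow> real" where "f z = ln (1 + exp z) - (z - y)^2 / 16" for z
  define f' :: "real \<Rightarrow> real" where "f' z = exp z / (1 + exp z) - (z - y) / 8" for z
  have pos: "1 + exp z > 0" for z :: real by (simp add: add_pos_pos)
  have d1: "(f has_real_derivative f' z) (at z)" for z
    unfolding f_def f'_def using pos[of z]
    by (auto intro!: derivative_eq_intros simp: field_simps)
  have d2: "(f' has_real_derivative exp z / (1 + exp z)^2 - 1/8) (at z)" for z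
  proof -
    have "((\<lambda>z. exp z / (1 + exp z)) has_real_derivative exp z / (1 + exp z)^2) (at z)"
      using pos[of z] by (auto intro!: derivative_eq_intros simp: field_simps power2_eq_square)
    moreover have "((\<lambda>z. (z - y) / 8) has_real_derivative 1/8) (at z)"
      by (auto intro!: derivative_eq_intros)
    ultimately show ?thesis unfolding f'_def by (rule DERIV_diff)
  qed
  have ge: "exp z / (1 + exp z)^2 - 1/8 \<ge> 0" if "z \<in> I" for z
  proof -
    have "\<bar>z / 2\<bar> \<le> arsinh 1" using that by (auto simp: I_def)
    then have "cosh (z / 2)^2 \<le> 2" by (rule cosh_square_le_two)
    moreover have "cosh (z / 2)^2 > 0" by simp
    ultimately show ?thesis unfolding logistic_variance by (simp add: field_simps)
  qed
  have xy: "x \<in> I" "y \<in> I" using assms by (auto simp: I_def)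
  have "f' y * (x - y) \<le> f x - f y"
    using d1 d2 ge xy by (intro f''_imp_f'[where C = I and f'' =
        "\<lambda>z. exp z / (1 + exp z)^2 - 1/8"]) (auto simp: I_def)
  then have "ln (1 + exp y) + (exp y / (1 + exp y) * (x - y) + (x - y)^2 / 16) \<le> ln (1 + exp x)"
    by (simp add: f_def f'_def)
  then have "exp (ln (1 + exp y) + (exp y / (1 + exp y) * (x - y) + (x - y)^2 / 16)) \<le>
      exp (ln (1 + exp x))"
    by simp
  then show ?thesis using pos[of x] pos[of y] by (simp add: exp_add)
qed


section \<open>Point probabilities of the binomial distribution\<close>

definition stirling_log :: "nat \<Rightarrow> real" where
  "stirling_log n = ln (fact n) + real n - (real n + 1/2) * ln (real n)"

text \<open>\<open>stirling_log n\<close> is the logarithm of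
  \<open>fact n / (sqrt n * (n / exp 1)^n)\<close>. Its increments involve the integral of
  \<open>1 / x\<close> over \<open>[n, n + 1]\<close>; by convexity the midpoint rule bounds this
  from below and the trapezoidal rule from above. The trapezoidal error telescopes as
  \<open>1 / (4 * n)\<close>.\<close>

lemma stirling_log_step:
  assumes "n \<ge> 1"
  shows "stirling_log (Suc n) \<le> stirling_log n"
    and "stirling_log n - 1 / (4 * real n) \<le> stirling_log (Suc n) - 1 / (4 * real (Suc n))"
proof -
  have n: "real n > 0" using assms by simp
  have eq: "stirling_log n - stirling_log (Suc n) = (real n + 1/2) * (ln (real n + 1) - ln (real n)) - 1"
  proof -
    have "ln (fact (Suc n)) = ln (real n + 1) + ln (fact n)"
      using ln_mult[of "real n + 1" "fact n"] n by (simp add: algebra_simps)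
    then show ?thesis by (simp add: stirling_log_def algebra_simps del: fact_Suc)
  qed
  have lo: "ln (real n + 1) - ln (real n) \<ge> 1 / (real n + 1/2)"
    using ln_inverse_approx_ge[of "real n" "real n + 1"] n by (simp add: field_simps)
  have "(real n + 1/2) * (1 / (real n + 1/2)) \<le> (real n + 1/2) * (ln (real n + 1) - ln (real n))"
    by (intro mult_left_mono lo) simp
  then show "stirling_log (Suc n) \<le> stirling_log n"
    using eq n by (simp add: field_simps)
  have hi: "ln (real n + 1) - ln (real n) \<le> (1 / real n + 1 / (real n + 1)) / 2"
    using ln_inverse_approx_le[of "real n" 1] n by (simp add: field_simps)
  have "(real n + 1/2) * (ln (real n + 1) - ln (real n)) \<le>
      (real n + 1/2) * ((1 / real n + 1 / (real n + 1)) / 2)"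
    by (intro mult_left_mono hi) simp
  also have "\<dots> = 1 + 1 / (4 * real n) - 1 / (4 * (real n + 1))"
    using n by (simp add: divide_simps) (simp add: algebra_simps)
  finally show "stirling_log n - 1 / (4 * real n) \<le> stirling_log (Suc n) - 1 / (4 * real (Suc n))"
    using eq by (simp add: algebra_simps)
qed

lemma stirling_log_antimono:
  assumes "1 \<le> m" "m \<le> n"
  shows "stirling_log n \<le> stirling_log m"
  using assms(2,1)
proof (induction rule: dec_induct)
  case (step n)
  then show ?case using stirling_log_step(1)[of n] by simp
qed simp

lemma stirling_log_corrected_mono:
  assumes "1 \<le> m" "m \<le> n"
  shows "stirling_log m - 1 / (4 * real m) \<le> stirling_log n - 1 / (4 * real n)"
  using assms(2,1)
proof (induction rule: dec_induct)
  case (step n)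
  then show ?case using stirling_log_step(2)[of n] by simp
qed simp

lemma wallis_product_eq_fact:
  "(\<Prod>k=1..n. (4 * real k^2) / (4 * real k^2 - 1)) =
     16^n * fact n^4 / (fact (2*n)^2 * (2 * real n + 1))"
proof (induction n)
  case (Suc n)
  define a :: real where "a = fact n"
  define b :: real where "b = fact (2 * n)"
  define c where "c = real n + 1"
  define d where "d = 2 * real n + 1"
  define e where "e = 2 * real n + 3"
  have nz: "b \<noteq> 0" "c > 0" "d > 0" "e > 0"
    by (simp_all add: b_def c_def d_def e_def add_nonneg_pos)
  have "(\<Prod>k=1..Suc n. (4 * real k^2) / (4 * real k^2 - 1)) =
      16^n * a^4 / (b^2 * d) * (4 * c^2 / (4 * c^2 - 1))"
    using Suc by (simp add: a_def b_def c_def d_def add.commute)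
  also have "4 * c^2 - 1 = d * e"
    by (simp add: c_def d_def e_def power2_eq_square algebra_simps)
  also have "16^n * a^4 / (b^2 * d) * (4 * c^2 / (d * e)) =
      16^Suc n * (c * a)^4 / ((2 * c * d * b)^2 * e)"
    using nz by (simp add: divide_simps power2_eq_square power4_eq_xxxx)
  also have "c * a = fact (Suc n)" by (simp add: a_def c_def algebra_simps)
  also have "2 * c * d * b = fact (2 * Suc n)" by (simp add: b_def c_def d_def algebra_simps)
  also have "e = 2 * real (Suc n) + 1" by (simp add: e_def)
  finally show ?case .
qed simp

text \<open>A limit \<open>l\<close> exists by monotonicity and boundedness. Its value comes from
  the Wallis product: \<open>2 * (2 * stirling_log n - stirling_log (2 * n))\<close> tends to
  \<open>2 * l\<close>, and also to \<open>ln (pi / 2) + 2 * ln 2 = ln (2 * pi)\<close>.\<close>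

lemma stirling_log_limit: "stirling_log \<longlonglongrightarrow> ln (2 * pi) / 2"
proof -
  define f where "f n = stirling_log (Suc n)" for n
  have "decseq f"
    unfolding f_def by (intro decseq_SucI) (use stirling_log_step(1) in simp)
  moreover have "f n \<ge> stirling_log 1 - 1/4" for n
  proof -
    have "stirling_log 1 - 1/4 \<le> stirling_log (Suc n) - 1 / (4 * real (Suc n))"
      using stirling_log_corrected_mono[of 1 "Suc n"] by simp
    moreover have "1 / (4 * real (Suc n)) \<ge> 0" by simp
    ultimately show ?thesis unfolding f_def by linarith
  qed
  ultimately obtain l where "f \<longlonglongrightarrow> l"
    using decseq_convergent[of f "stirling_log 1 - 1/4"] by blast
  then have l: "stirling_log \<longlonglongrightarrow> l"
    unfolding f_def by (rule LIMSEQ_imp_Suc)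
  then have l2: "(\<lambda>n. stirling_log (2 * n)) \<longlonglongrightarrow> l"
    by (rule filterlim_compose) real_asymp
  have W: "(\<lambda>n. ln (16^n * fact n^4 / (fact (2*n)^2 * (2 * real n + 1)))) \<longlonglongrightarrow> ln (pi / 2)"
    using tendsto_ln[OF wallis] unfolding wallis_product_eq_fact by simp
  have "\<forall>\<^sub>F n in sequentially. 2 * (2 * stirling_log n - stirling_log (2 * n)) =
       ln (16^n * fact n^4 / (fact (2*n)^2 * (2 * real n + 1))) + ln 2 + (ln (2 * real n +
           1) - ln (real n))"
    using eventually_gt_at_top[of 0]
  proof eventually_elim
    case (elim n)
    have "ln (16::real) = 4 * ln 2" using ln_realpow[of 2 4] by simp
    moreover have "2 * real n + 1 > 0" by simp
    ultimately have "ln (16^n * fact n^4 / (fact (2*n)^2 * (2 * real n + 1))) =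
        4 * real n * ln 2 + 4 * ln (fact n) - 2 * ln (fact (2 * n)) - ln (2 * real n + 1)"
      by (simp add: ln_div ln_mult ln_realpow)
    moreover have "ln (real (2 * n)) = ln 2 + ln (real n)" using elim by (simp add: ln_mult)
    ultimately show ?case
      unfolding stirling_log_def by (simp only:) (simp add: algebra_simps)
  qed
  moreover have "(\<lambda>n. ln (16^n * fact n^4 / (fact (2*n)^2 * (2 * real n + 1))) + ln 2 +
      (ln (2 * real n + 1) - ln (real n))) \<longlonglongrightarrow> ln (pi / 2) + ln 2 + ln 2"
    by (intro tendsto_add W tendsto_const) real_asymp
  ultimately have "(\<lambda>n. 2 * (2 * stirling_log n - stirling_log (2 * n))) \<longlonglongrightarrow> ln (pi / 2) + ln 2 + ln 2"
    by (simp only: tendsto_cong)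
  moreover have "(\<lambda>n. 2 * (2 * stirling_log n - stirling_log (2 * n))) \<longlonglongrightarrow> 2 * (2 * l - l)"
    by (intro tendsto_intros l l2)
  ultimately have "2 * l = ln (pi / 2) + ln 2 + ln 2"
    using LIMSEQ_unique by fastforce
  then have "l = ln (2 * pi) / 2"
    by (simp add: ln_mult ln_div)
  with l show ?thesis by simp
qed

lemma fact_eq_stirling_log:
  assumes "n \<ge> 1"
  shows "fact n = exp (stirling_log n) * sqrt (real n) * (real n / exp 1)^n"
proof -
  have "exp (stirling_log n) * sqrt (real n) * (real n / exp 1)^n =
      exp (stirling_log n + ln (real n) / 2 + real n * (ln (real n) - 1))"
    using assms by (simp add: exp_add exp_of_nat_mult exp_diff ln_sqrt[symmetric])
  also have "\<dots> = exp (ln (fact n))"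
    by (simp add: stirling_log_def algebra_simps)
  finally show ?thesis by simp
qed

lemma exp_half_ln_two_pi: "exp (ln (2 * pi) / 2) = sqrt (2 * pi)"
  by (simp add: ln_sqrt[symmetric])

text \<open>A decreasing sequence stays above its limit.\<close>

lemma stirling_lower:
  assumes "n \<ge> 1"
  shows "sqrt (2 * pi * real n) * (real n / exp 1)^n \<le> fact n"
proof -
  have "ln (2 * pi) / 2 \<le> stirling_log n"
    by (intro LIMSEQ_le_const2[OF stirling_log_limit] exI[of _ n]) (use assms stirling_log_antimono in
        blast)
  then have "sqrt (2 * pi) \<le> exp (stirling_log n)"
    by (subst exp_half_ln_two_pi[symmetric]) simp
  then show ?thesis
    unfolding fact_eq_stirling_log[OF assms] real_sqrt_mult
    by (intro mult_right_mono) (auto simp: real_sqrt_mult)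
qed

text \<open>The corrected sequence increases to the same limit, so it stays below it.\<close>

lemma stirling_upper:
  assumes "n \<ge> 1"
  shows "fact n \<le> exp (1 / (4 * real n)) * sqrt (2 * pi * real n) * (real n / exp 1)^n"
proof -
  have "(\<lambda>n. stirling_log n - 1 / (4 * real n)) \<longlonglongrightarrow> ln (2 * pi) / 2 - 0"
    by (intro tendsto_diff stirling_log_limit) real_asymp
  then have "stirling_log n - 1 / (4 * real n) \<le> ln (2 * pi) / 2 - 0"
    by (rule LIMSEQ_le_const) (use assms stirling_log_corrected_mono in blast)
  then have "stirling_log n \<le> 1 / (4 * real n) + ln (2 * pi) / 2" by simp
  then have "exp (stirling_log n) \<le> exp (1 / (4 * real n)) * sqrt (2 * pi)"
    by (subst exp_half_ln_two_pi[symmetric], subst exp_add[symmetric]) simp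
  then show ?thesis
    unfolding fact_eq_stirling_log[OF assms] real_sqrt_mult mult.assoc[symmetric]
    by (intro mult_right_mono) (auto simp: real_sqrt_mult)
qed

section \<open>Uniform bounds for binomial probabilities, written as Bernstein polynomials\<close>

lemma Bernstein_le_at_peak:
  assumes "1 \<le> x" "x < i" "0 < p" "p < 1"
  shows "Bernstein i x p \<le> Bernstein i x (real x / real i)"
proof -
  define y where "y = real x / real i"
  have y: "0 < y" "y < 1" using assms by (auto simp: y_def)
  \<comment> \<open>Gibbs' inequality: after \<open>ln t \<le> t - 1\<close> the linear terms
    cancel, precisely because \<open>y = x / i\<close>.\<close>
  have "real x * ln (p / y) + real (i - x) * ln ((1 - p) / (1 - y))
        \<le> real x * (p / y - 1) + real (i - x) * ((1 - p) / (1 - y) - 1)"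
    using assms y by (intro add_mono mult_left_mono ln_le_minus_one) auto
  also have "\<dots> = 0"
    using assms by (simp add: y_def of_nat_diff field_simps)
  finally have "exp (real x * ln (p / y) + real (i - x) * ln ((1 - p) / (1 - y))) \<le> 1"
    by simp
  then have "(p / y)^x * ((1 - p) / (1 - y))^(i - x) \<le> 1"
    using assms y by (simp add: exp_add exp_of_nat_mult del: of_nat_diff)
  then have "p^x * (1 - p)^(i - x) \<le> y^x * (1 - y)^(i - x)"
    using y by (simp add: power_divide field_simps)
  then show ?thesis
    unfolding Bernstein_def y_def[symmetric] mult.assoc by (rule mult_left_mono) simp
qed

text \<open>Stirling from above for \<open>i\<close> and from below for \<open>x\<close> and
  \<open>i - x\<close>. The powers \<open>(k / exp 1)^k\<close> cancel exactly against
  \<open>y^x * (1 - y)^(i - x)\<close>, so only the square roots and one error factor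
  survive.\<close>

lemma Bernstein_peak_le:
  assumes "1 \<le> x" "x < i"
  defines "y \<equiv> real x / real i"
  shows "Bernstein i x y \<le> exp (1 / (4 * real i)) / sqrt (2 * pi * real i * (y * (1 - y)))"
proof -
  define z where "z = i - x"
  have z: "1 \<le> z" "i = x + z" using assms by (auto simp: z_def)
  have pos: "real x > 0" "real z > 0" "real i > 0" using assms z by simp_all
  define s where "s k = sqrt (2 * pi * real k) * (real k / exp 1)^k" for k
  have s: "s k > 0" if "k \<ge> 1" for k using that by (simp add: s_def)
  have y: "y = real x / real i" "1 - y = real z / real i"
    using assms z by (auto simp: field_simps y_def)
  have ch: "real (i choose x) = fact i / (fact x * fact z)"
    using z binomial_fact[of x i] by simp
  also have "\<dots> \<le> (exp (1 / (4 * real i)) * s i) / (s x * s z)"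
    using stirling_upper[of i] stirling_lower[of x] stirling_lower[of z] assms z s[of x] s[of z]
    by (intro frac_le mult_mono) (auto simp: s_def mult.assoc)
  finally have "Bernstein i x y \<le> (exp (1 / (4 * real i)) * s i) / (s x * s z) * (y^x * (1 - y)^z)"
    using y assms unfolding Bernstein_def z_def[symmetric] mult.assoc
    by (intro mult_right_mono) auto
  also have "s i / (s x * s z) * (y^x * (1 - y)^z) =
      sqrt (2 * pi * real i) / (sqrt (2 * pi * real x) * sqrt (2 * pi * real z))"
    unfolding y s_def z(2) power_divide power_add
    using assms z by (simp add: field_simps)
  then have "(exp (1 / (4 * real i)) * s i) / (s x * s z) * (y^x * (1 - y)^z) = 
     exp (1 / (4 * real i)) * (sqrt (2 * pi * real i) / (sqrt (2 * pi * real x) * sqrt (2 * pi *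
         real z)))"
    by (metis (no_types, lifting) mult.assoc times_divide_eq_right)
  also have "sqrt (2 * pi * real i) / (sqrt (2 * pi * real x) * sqrt (2 * pi * real z)) =
      sqrt (1 / (2 * pi * real i * (y * (1 - y))))"
    unfolding real_sqrt_mult[symmetric] real_sqrt_divide[symmetric] y(2) unfolding y(1)
    using pos by (intro arg_cong[where f = sqrt]) (simp add: field_simps)
  finally show ?thesis by (simp add: real_sqrt_divide)
qed

text \<open>A single term of the sum for the variance. It handles values \<open>x\<close> far from
  the mean, where a bound of order \<open>1 / i\<close> is enough.\<close>

lemma Bernstein_chebyshev:
  assumes "0 \<le> p" "p \<le> 1" "x \<le> i"
  shows "(real x - real i * p)^2 * Bernstein i x p \<le> real i * (p * (1 - p))"
proof -
  have "(real x - real i * p)^2 * Bernstein i x p \<le> (\<Sum>k\<le>i. (real k - real i * p)^2 * Bernstein i k p)"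
    by (rule member_le_sum[where f = "\<lambda>k. (real k - real i * p)^2 * Bernstein i k p"])
       (use assms in \<open>auto simp: Bernstein_nonneg\<close>)
  also have "\<dots> = (\<Sum>k\<le>i. real k * (real k - 1) * Bernstein i k p +
      (1 - 2 * real i * p) * (real k * Bernstein i k p)
      + (real i * p)^2 * Bernstein i k p)"
    by (intro sum.cong) (auto simp: algebra_simps power2_eq_square)
  also have "\<dots> = real i * (p * (1 - p))"
    by (simp only: sum.distrib sum_distrib_left[symmetric] sum_kk_Bernstein sum_k_Bernstein sum_Bernstein)
       (simp add: algebra_simps power2_eq_square)
  finally show ?thesis .
qed

text \<open>Within \<open>i / 1000\<close> of the mean, the bound at the peak applies with
  \<open>y = x / i\<close> close to \<open>p\<close>; farther out, Chebyshev is stronger for large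
  \<open>i\<close>. The factor 102/100 is the product of 101/100 for the Stirling error and 102/101
  for replacing \<open>y\<close> by \<open>p\<close>.\<close>

lemma Bernstein_le_eventually:
  "\<exists>i0\<ge>1. \<forall>i\<ge>i0. \<forall>x\<le>i. \<forall>p. 0 < p \<longrightarrow> p < 1 \<longrightarrow> 1/8 \<le> p * (1 - p) \<longrightarrow>
     Bernstein i x p \<le> 102/100 / sqrt (2 * pi * real i * (p * (1 - p)))"
proof -
  have "\<forall>\<^sub>F i::nat in sequentially. exp (1 / (4 * real i)) \<le> 101/100" by real_asymp
  \<comment> \<open>250000 is \<open>1000^2 / 4\<close>: Chebyshev at distance
    \<open>i / 1000\<close> with \<open>p * (1 - p) \<le> 1/4\<close>.\<close>
  moreover have "\<forall>\<^sub>F i::nat in sequentially. 250000 / real i \<le> 1 / sqrt (2 * pi * real i * 1)"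
      by real_asymp
  ultimately have "\<forall>\<^sub>F i::nat in sequentially. i \<ge> 1 \<and> exp (1 / (4 * real i)) \<le> 101/100 \<and> 250000 / real i \<le>
      1 / sqrt (2 * pi * real i * 1)"
    using eventually_ge_at_top[of 1] by eventually_elim simp
  then obtain i0 where i0: "\<And>i. i \<ge> i0 \<Longrightarrow> i \<ge> 1 \<and> exp (1 / (4 * real i)) \<le> 101/100 \<and> 250000 / real i \<le>
      1 / sqrt (2 * pi * real i * 1)"
    by (auto simp: eventually_sequentially)
  have "Bernstein i x p \<le> 102/100 / sqrt (2 * pi * real i * (p * (1 - p)))"
    if i: "i \<ge> i0" and x: "x \<le> i" and p: "0 < p" "p < 1" "1/8 \<le> p * (1 - p)" for i x p
  proof (cases "\<bar>real x - real i * p\<bar> \<le> real i / 1000")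
    case True
    have i1: "i \<ge> 1" using i0[OF i] by simp
    have "p * (1 - p) \<le> p" "p * (1 - p) \<le> 1 - p"
      using mult_left_mono[of "1 - p" 1 p] mult_right_mono[of p 1 "1 - p"] p by simp_all
    then have "1/8 \<le> p" "1/8 \<le> 1 - p" using p(3) by (meson order.trans)+
    then have p8: "1/8 \<le> p" "p \<le> 7/8" by simp_all
    then have "real i / 8 \<le> real i * p" "real i * p \<le> real i * (7/8)"
      using mult_left_mono[OF p8(1), of "real i"] mult_left_mono[OF p8(2), of "real i"] by auto
    then have "real x > 0" "real x < real i" using True i1 by linarith+
    then have x1: "1 \<le> x" "x < i" by auto
    define y where "y = real x / real i"
    have "y - p = (real x - real i * p) / real i"
      using i1 by (simp add: y_def field_simps)
    then have "\<bar>y - p\<bar> = \<bar>real x - real i * p\<bar> / real i" by simp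
    also have "\<dots> \<le> 1/1000" using True i1 by (simp add: field_simps)
    finally have yp: "\<bar>y - p\<bar> \<le> 1/1000" .
    have "p * (1 - p) - y * (1 - y) = (p - y) * (1 - p - y)" by (simp add: algebra_simps)
    also have "\<dots> \<le> \<bar>p - y\<bar> * \<bar>1 - p - y\<bar>" by (metis abs_ge_self abs_mult)
    also have "\<dots> \<le> 1/1000 * 1"
    proof (rule mult_mono)
      show "\<bar>p - y\<bar> \<le> 1/1000" "\<bar>1 - p - y\<bar> \<le> 1" using yp p8 by linarith+
    qed auto
    finally have "y * (1 - y) \<ge> p * (1 - p) - 1/1000" by simp
    \<comment> \<open>Since \<open>p * (1 - p) \<ge> 1/8\<close>, the loss of 1/1000 is a relative
      loss of at most 1/125, below \<open>1 - (101/102)^2\<close>.\<close>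
    also have "p * (1 - p) - 1/1000 \<ge> (101/102)^2 * (p * (1 - p))"
      using p(3) by (simp add: power2_eq_square)
    finally have yy: "y * (1 - y) \<ge> (101/102)^2 * (p * (1 - p))" .
    have "Bernstein i x p \<le> exp (1 / (4 * real i)) / sqrt (2 * pi * real i * (y * (1 - y)))"
      using Bernstein_le_at_peak[OF x1 p(1,2)] Bernstein_peak_le[OF x1] by (simp add: y_def)
    also have "\<dots> \<le> (101/100) / sqrt (2 * pi * real i * ((101/102)^2 * (p * (1 - p))))"
      using i0[OF i] i1 yy p by (intro frac_le real_sqrt_le_mono mult_left_mono) auto
    also have "sqrt (2 * pi * real i * ((101/102)^2 * (p * (1 - p)))) =
        101/102 * sqrt (2 * pi * real i * (p * (1 - p)))"
      by (simp add: real_sqrt_mult)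
    finally show ?thesis by simp
  next
    case False
    have i1: "i \<ge> 1" using i0[OF i] by simp
    have "(real i / 1000)^2 * Bernstein i x p \<le> (real x - real i * p)^2 * Bernstein i x p"
      using False p by (intro mult_right_mono Bernstein_nonneg) (auto simp: abs_le_square_iff[symmetric]
          simp del: power_divide)
    also have "\<dots> \<le> real i * (p * (1 - p))" using Bernstein_chebyshev[of p x i] p x by simp
    also have "p * (1 - p) \<le> 1/4" using zero_le_square[of "p - 1/2"] by (simp add: algebra_simps)
    finally have "Bernstein i x p \<le> 250000 / real i"
      using i1 by (simp add: field_simps power2_eq_square)
    also have "\<dots> \<le> 1 / sqrt (2 * pi * real i * 1)" using i0[OF i] by simp
    also have "\<dots> \<le> (102/100) / sqrt (2 * pi * real i * (p * (1 - p)))"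
      using p i1 mult_mono[of p 1 "1-p" 1] by (intro frac_le real_sqrt_le_mono mult_left_mono) auto
    finally show ?thesis .
  qed
  then show ?thesis using i0 by (intro exI[of _ "max 1 i0"]) auto
qed


section \<open>Gaussian sums over the vertex weights\<close>

lemma gaussian_has_integral_halfline:
  "((\<lambda>t::real. exp (- t\<^sup>2)) has_integral sqrt pi / 2) {0..}"
proof -
  note g = gaussian_moment_0[unfolded has_bochner_integral_iff]
  have "((\<lambda>t::real. indicator {0..} t *\<^sub>R exp (- t\<^sup>2)) has_integral sqrt pi / 2) UNIV"
    using has_integral_integral_lborel[OF conjunct1[OF g]] unfolding conjunct2[OF g] .
  moreover have "(\<lambda>t. indicator {0..} t *\<^sub>R exp (- t\<^sup>2)) = (\<lambda>t::real. if t \<in> {0..} then exp (- t\<^sup>2) else 0)"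
    by (auto simp: indicator_def)
  ultimately show ?thesis by (simp only: has_integral_restrict_UNIV)
qed

text \<open>Riemann sum with mesh \<open>s\<close> evaluated at right endpoints: as
  \<open>exp (- t\<^sup>2)\<close> decreases for nonnegative \<open>t\<close>, the sum times
  \<open>s\<close> is at most the half-line integral.\<close>

lemma sum_gaussian_halfline_le:
  fixes s y :: real
  assumes "s > 0" "y \<ge> 0"
  shows "(\<Sum>j=1..N. exp (- (s * (real j + y))\<^sup>2)) \<le> sqrt pi / (2 * s)"
proof -
  define f :: "real \<Rightarrow> real" where "f t = exp (- t\<^sup>2)" for t
  define F where "F x = integral {0..x} f" for x
  have int: "f integrable_on {a..b}" for a b
    unfolding f_def by (intro integrable_continuous_real continuous_intros)
  have F: "F x \<le> sqrt pi / 2" for x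
  proof -
    have "f integrable_on {0..}"
      using has_integral_integrable[OF gaussian_has_integral_halfline] by (simp add: f_def[abs_def])
    then have "F x \<le> integral {0..} f"
      unfolding F_def using int by (intro integral_subset_le) (auto simp: f_def)
    then show ?thesis using gaussian_has_integral_halfline unfolding f_def[abs_def]
      by (simp add: integral_unique)
  qed
  have step: "f b * (b - a) \<le> F b - F a" if "0 \<le> a" "a \<le> b" for a b
  proof -
    have "F a + integral {a..b} f = F b"
      unfolding F_def using that int by (intro Henstock_Kurzweil_Integration.integral_combine) auto
    moreover have "integral {a..b} (\<lambda>_. f b) \<le> integral {a..b} f"
      using that int by (intro integral_le) (auto simp: f_def intro!: power_mono)
    ultimately show ?thesis using that by (simp add: mult.commute)
  qed
  have "(\<Sum>j=1..N. f (s * (real j + y)) * s) \<le> F (s * (real N + y)) - F (s * y)"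
  proof (induction N)
    case (Suc N)
    have "f (s * (real (Suc N) + y)) * (s * (real (Suc N) + y) - s * (real N + y))
        \<le> F (s * (real (Suc N) + y)) - F (s * (real N + y))"
      using assms by (intro step) auto
    moreover have "s * (real (Suc N) + y) - s * (real N + y) = s" by (simp add: algebra_simps)
    ultimately show ?case using Suc by simp
  qed simp
  also have "\<dots> \<le> sqrt pi / 2"
    using F[of "s * (real N + y)"] integral_nonneg[OF int, of 0 "s * y"]
    by (simp add: F_def f_def)
  finally have "(\<Sum>j=1..N. f (s * (real j + y))) * s \<le> sqrt pi / 2"
    by (simp add: sum_distrib_right)
  then show ?thesis using assms by (simp add: f_def field_simps)
qed

text \<open>The two integers around \<open>x\<close> contribute at most 1 each, and the integers on
  either side of them form a half-line sum.\<close>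

lemma sum_gaussian_progression_le:
  fixes s x :: real
  assumes "s > 0"
  shows "(\<Sum>i<n. exp (- (s * (real i - x))\<^sup>2)) \<le> 2 + sqrt pi / s"
proof -
  define c where "c = \<lfloor>x\<rfloor>"
  have c: "of_int c \<le> x" "x \<le> of_int c + 1" unfolding c_def by linarith+
  \<comment> \<open>Large enough for the two half-lines starting next to \<open>c\<close> and
    \<open>c + 1\<close> to reach every index below \<open>n\<close>.\<close>
  define N where "N = n + nat \<bar>c\<bar>"
  define g where "g i = exp (- (s * (of_int i - x))\<^sup>2)" for i :: int
  have g0: "g i \<ge> 0" for i by (simp add: g_def)
  have g1: "g i \<le> 1" for i by (simp add: g_def)
  define L where "L = (\<lambda>j. c - int j) ` {1..N}"
  define R where "R = (\<lambda>j. c + 1 + int j) ` {1..N}"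
  have sub: "int ` {..<n} \<subseteq> L \<union> ({c, c + 1} \<union> R)"
  proof
    fix z assume "z \<in> int ` {..<n}"
    then have z: "0 \<le> z" "z < int n" by auto
    consider "z \<le> c - 1" | "z = c \<or> z = c + 1" | "z \<ge> c + 2" by linarith
    then show "z \<in> L \<union> ({c, c + 1} \<union> R)"
    proof cases
      case 1
      then have "z = c - int (nat (c - z))" "nat (c - z) \<in> {1..N}"
        using z by (auto simp: N_def)
      then show ?thesis unfolding L_def by blast
    next
      case 3
      then have "z = c + 1 + int (nat (z - c - 1))" "nat (z - c - 1) \<in> {1..N}"
        using z by (auto simp: N_def)
      then show ?thesis unfolding R_def by blast
    qed auto
  qed
  have fin: "finite L" "finite R" by (auto simp: L_def R_def)
  have un: "sum g (A \<union> B) \<le> sum g A + sum g B" if "finite A" "finite B" for A B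
    using that g0 by (subst sum_Un) (auto intro!: sum_nonneg)
  have "(\<Sum>i<n. exp (- (s * (real i - x))\<^sup>2)) = (\<Sum>z\<in>int ` {..<n}. g z)"
    by (subst sum.reindex) (auto simp: g_def)
  also have "\<dots> \<le> sum g (L \<union> ({c, c + 1} \<union> R))"
    using sub fin g0 by (intro sum_mono2) auto
  also have "\<dots> \<le> sum g L + (sum g {c, c + 1} + sum g R)"
    using fin un[of L "{c, c + 1} \<union> R"] un[of "{c, c + 1}" R] by auto
  also have "sum g {c, c + 1} \<le> 2"
    using g1[of c] g1[of "c + 1"] by simp
  also have "sum g L = (\<Sum>j=1..N. exp (- (s * (real j + (x - of_int c)))\<^sup>2))"
  proof -
    have "(s * (of_int c - real j - x))\<^sup>2 = (s * (real j + (x - of_int c)))\<^sup>2" for j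
      by (simp add: power2_eq_square algebra_simps)
    then show ?thesis unfolding L_def by (subst sum.reindex) (auto simp: g_def inj_on_def)
  qed
  also have "\<dots> \<le> sqrt pi / (2 * s)"
    using assms c by (intro sum_gaussian_halfline_le) auto
  also have "sum g R = (\<Sum>j=1..N. exp (- (s * (real j + (of_int c + 1 - x)))\<^sup>2))"
    unfolding R_def by (subst sum.reindex) (auto simp: g_def inj_on_def algebra_simps)
  also have "\<dots> \<le> sqrt pi / (2 * s)"
    using assms c by (intro sum_gaussian_halfline_le) auto
  finally show ?thesis by (simp add: field_simps)
qed

text \<open>The inverse function \<open>a \<mapsto> arctan (sinh a)\<close> has derivative \<open>1 / cosh a\<close>, so the number of weights
  near \<open>a\<close> is proportional to \<open>1 / cosh a\<close>. This cancels the factor \<open>cosh \<theta>\<close> in the bound for the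
  binomial probabilities with \<open>p (1 - p) = 1 / (4 (cosh \<theta>)\<^sup>2)\<close>.\<close>

definition vertex_weight :: "nat \<Rightarrow> nat \<Rightarrow> real" where
  "vertex_weight n i = arsinh (tan (pi / 2 * real i / real n - pi / 4))"

lemma vertex_angle_bounds:
  assumes "i < n"
  shows "- (pi / 4) \<le> pi / 2 * real i / real n - pi / 4" "pi / 2 * real i / real n - pi / 4 \<le> pi / 4"
proof -
  have "real i / real n \<le> 1" using assms by simp
  then have "pi / 2 * (real i / real n) \<le> pi / 2 * 1" by (intro mult_left_mono) auto
  then show "pi / 2 * real i / real n - pi / 4 \<le> pi / 4" by simp
qed simp

lemma abs_vertex_weight_le:
  assumes "i < n"
  shows "\<bar>vertex_weight n i\<bar> \<le> arsinh 1"
proof -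
  define u where "u = pi / 2 * real i / real n - pi / 4"
  have u: "- (pi / 4) \<le> u" "u \<le> pi / 4" using vertex_angle_bounds[OF assms] by (auto simp: u_def)
  have b: "- (pi / 2) < u" "u < pi / 2" using u pi_gt_zero by linarith+
  have "tan u \<le> tan (pi / 4)" using u b by (subst tan_mono_le_eq) auto
  moreover have "tan (- (pi / 4)) \<le> tan u" using u b by (subst tan_mono_le_eq) auto
  ultimately have "\<bar>tan u\<bar> \<le> 1" by (simp add: tan_45)
  then have t: "tan u \<le> 1" "-1 \<le> tan u" by linarith+
  have "arsinh x \<le> arsinh y" if "x \<le> y" for x y :: real
    using that by (metis arsinh_less_iff_real not_le)
  from this[OF t(1)] this[OF t(2)] have "arsinh (tan u) \<le> arsinh 1" "arsinh (-1) \<le> arsinh (tan u)" .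
  then show ?thesis by (auto simp: vertex_weight_def u_def)
qed

lemma arctan_sinh_vertex_weight:
  assumes "i < n"
  shows "arctan (sinh (vertex_weight n i)) = pi / 2 * real i / real n - pi / 4"
  using vertex_angle_bounds[OF assms] pi_gt_zero unfolding vertex_weight_def sinh_arsinh_real
  by (intro arctan_tan) linarith+

text \<open>Mean value estimate with derivative \<open>1 / cosh\<close>; moving by at most
  \<open>\<epsilon>\<close> lowers \<open>cosh\<close> by at most the factor
  \<open>exp \<epsilon>\<close>. Keeping \<open>cosh \<theta>\<close> in the bound, instead of a
  uniform constant, is what permits the later cancellation.\<close>

lemma arctan_sinh_diff_le:
  fixes z \<theta> :: real
  assumes "\<bar>z - \<theta>\<bar> \<le> \<epsilon>"
  shows "\<bar>arctan (sinh z) - arctan (sinh \<theta>)\<bar> \<le> exp \<epsilon> / cosh \<theta> * \<bar>z - \<theta>\<bar>"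
proof -
  have der: "((\<lambda>z. arctan (sinh z)) has_real_derivative 1 / cosh w) (at w)" for w :: real
  proof -
    have "((\<lambda>z. arctan (sinh z)) has_real_derivative cosh w / (1 + (sinh w)\<^sup>2)) (at w)"
      by (auto intro!: derivative_eq_intros simp: divide_inverse)
    moreover have "1 + (sinh w)\<^sup>2 = cosh w * cosh w"
      using cosh_square_eq[of w] by (simp add: power2_eq_square)
    ultimately show ?thesis by simp
  qed
  have cosh_ge: "exp (- \<epsilon>) * cosh \<theta> \<le> cosh w" if "\<bar>w - \<theta>\<bar> \<le> \<epsilon>" for w
  proof -
    have "exp (\<theta> - \<epsilon>) \<le> exp w" "exp (- \<theta> - \<epsilon>) \<le> exp (- w)" using that by simp_all
    then have "(exp (\<theta> - \<epsilon>) + exp (- \<theta> - \<epsilon>)) / 2 \<le> (exp w + exp (- w)) / 2"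
      by (intro divide_right_mono add_mono) auto
    moreover have "exp (- \<epsilon>) * cosh \<theta> = (exp (\<theta> - \<epsilon>) + exp (- \<theta> - \<epsilon>)) / 2"
      by (simp add: cosh_field_def distrib_left exp_add[symmetric] add.commute)
    ultimately show ?thesis by (simp only: cosh_field_def[of w])
  qed
  have "norm (arctan (sinh z) - arctan (sinh \<theta>)) \<le> exp \<epsilon> / cosh \<theta> * norm (z - \<theta>)"
  proof (rule field_differentiable_bound[where S = "cball \<theta> \<epsilon>" and f' = "\<lambda>w. 1 / cosh w"])
    fix w assume "w \<in> cball \<theta> \<epsilon>"
    then have "\<bar>w - \<theta>\<bar> \<le> \<epsilon>" by (simp add: dist_real_def abs_minus_commute)
    from cosh_ge[OF this] have "1 / cosh w \<le> 1 / (exp (- \<epsilon>) * cosh \<theta>)"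
      by (intro divide_left_mono) auto
    then show "norm (1 / cosh w) \<le> exp \<epsilon> / cosh \<theta>" by (simp add: exp_minus field_simps)
    show "((\<lambda>z. arctan (sinh z)) has_real_derivative 1 / cosh w) (at w within cball \<theta> \<epsilon>)"
      by (rule has_field_derivative_at_within[OF der])
  qed (use assms in \<open>auto simp: dist_real_def abs_minus_commute\<close>)
  then show ?thesis by simp
qed

text \<open>Weights farther than \<open>\<epsilon>\<close> from \<open>\<theta>\<close> give the
  exponentially small term. For the others, the angles \<open>arctan (sinh a)\<close> are equally
  spaced, so the distance to \<open>\<theta>\<close> dominates a multiple of
  \<open>\<bar>i - x\<bar>\<close> and the sum over a progression applies.\<close>

lemma sum_gaussian_vertex_weight_le:
  fixes \<theta> l \<epsilon> :: real
  assumes "n \<ge> 1" "l > 0" "\<epsilon> > 0"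
  shows "(\<Sum>i<n. exp (- (l * (vertex_weight n i - \<theta>)\<^sup>2)))
     \<le> real n * exp (- (l * \<epsilon>\<^sup>2)) + 2 + 2 * real n / pi * (exp \<epsilon> / cosh \<theta>) * sqrt (pi / l)"
proof -
  define h where "h = pi / 2 / real n"
  define s where "s = sqrt l * (cosh \<theta> / exp \<epsilon>) * h"
  \<comment> \<open>The possibly fractional index whose angle is that of \<open>\<theta>\<close>;
    \<open>h\<close> is the spacing of the angles.\<close>
  define x where "x = (arctan (sinh \<theta>) + pi / 4) / h"
  have h: "h > 0" using assms by (simp add: h_def)
  have s: "s > 0" using assms h by (simp add: s_def)
  have "exp (- (l * (vertex_weight n i - \<theta>)\<^sup>2)) \<le> exp (- (l * \<epsilon>\<^sup>2)) + exp (- (s * (real i - x))\<^sup>2)"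
    if i: "i < n" for i
  proof (cases "\<bar>vertex_weight n i - \<theta>\<bar> \<le> \<epsilon>")
    case True
    have "h * x = arctan (sinh \<theta>) + pi / 4" using h by (simp add: x_def)
    moreover have "h * real i = pi / 2 * real i / real n" by (simp add: h_def)
    ultimately have "h * (real i - x) = arctan (sinh (vertex_weight n i)) - arctan (sinh \<theta>)"
      unfolding arctan_sinh_vertex_weight[OF i] by (simp add: right_diff_distrib)
    then have "\<bar>h * (real i - x)\<bar> \<le> exp \<epsilon> / cosh \<theta> * \<bar>vertex_weight n i - \<theta>\<bar>"
      using arctan_sinh_diff_le[OF True] by simp
    then have "(cosh \<theta> / exp \<epsilon>) * \<bar>h * (real i - x)\<bar> \<le>
        (cosh \<theta> / exp \<epsilon>) * (exp \<epsilon> / cosh \<theta> * \<bar>vertex_weight n i - \<theta>\<bar>)"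
      by (intro mult_left_mono) auto
    then have "(cosh \<theta> / exp \<epsilon>) * \<bar>h * (real i - x)\<bar> \<le> \<bar>vertex_weight n i - \<theta>\<bar>"
      by simp
    then have "sqrt l * ((cosh \<theta> / exp \<epsilon>) * \<bar>h * (real i - x)\<bar>) \<le> sqrt l * \<bar>vertex_weight n i - \<theta>\<bar>"
      using assms by (intro mult_left_mono) auto
    then have "\<bar>s * (real i - x)\<bar> \<le> \<bar>sqrt l * (vertex_weight n i - \<theta>)\<bar>"
      using assms h by (simp add: s_def abs_mult mult_ac)
    then have "(s * (real i - x))\<^sup>2 \<le> (sqrt l * (vertex_weight n i - \<theta>))\<^sup>2"
      by (simp only: abs_le_square_iff)
    then have "(s * (real i - x))\<^sup>2 \<le> l * (vertex_weight n i - \<theta>)\<^sup>2"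
      using assms by (simp add: power_mult_distrib)
    then have "exp (- (l * (vertex_weight n i - \<theta>)\<^sup>2)) \<le> exp (- (s * (real i - x))\<^sup>2)" by simp
    also have "\<dots> \<le> exp (- (l * \<epsilon>\<^sup>2)) + exp (- (s * (real i - x))\<^sup>2)" by simp
    finally show ?thesis .
  next
    case False
    then have "\<epsilon>\<^sup>2 \<le> (vertex_weight n i - \<theta>)\<^sup>2"
      using assms abs_le_square_iff[of \<epsilon> "vertex_weight n i - \<theta>"] by simp
    then have "exp (- (l * (vertex_weight n i - \<theta>)\<^sup>2)) \<le> exp (- (l * \<epsilon>\<^sup>2))"
      using assms by simp
    also have "\<dots> \<le> exp (- (l * \<epsilon>\<^sup>2)) + exp (- (s * (real i - x))\<^sup>2)" by simp
    finally show ?thesis .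
  qed
  then have "(\<Sum>i<n. exp (- (l * (vertex_weight n i - \<theta>)\<^sup>2)))
      \<le> (\<Sum>i<n. exp (- (l * \<epsilon>\<^sup>2)) + exp (- (s * (real i - x))\<^sup>2))"
    by (intro sum_mono) simp
  also have "\<dots> = real n * exp (- (l * \<epsilon>\<^sup>2)) + (\<Sum>i<n. exp (- (s * (real i - x))\<^sup>2))"
    by (simp add: sum.distrib)
  also have "\<dots> \<le> real n * exp (- (l * \<epsilon>\<^sup>2)) + (2 + sqrt pi / s)"
    using sum_gaussian_progression_le[OF s, of x n] by simp
  also have "sqrt pi / s = 2 * real n / pi * (exp \<epsilon> / cosh \<theta>) * sqrt (pi / l)"
    using assms by (simp add: s_def h_def real_sqrt_divide mult_ac)
  finally show ?thesis by simp
qed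


section \<open>Probability of a regular induced subgraph\<close>

lemma prod_powers_eq_choose_two:
  fixes y :: "'a::comm_semiring_1"
  shows "(\<Prod>i<m. y^i) = y^(m choose 2)"
proof (induction m)
  case (Suc m)
  have "Suc m choose 2 = (m choose 2) + m" by (simp add: numeral_2_eq_2)
  then show ?case using Suc by (simp add: power_add)
qed (simp add: numeral_2_eq_2)

text \<open>All \<open>d\<close>-regular graphs on \<open>S\<close> have the same probability, so their number can be bounded in the
  model where every vertex has weight \<open>\<theta>\<close>. Strict convexity of \<open>ln (1 + exp x)\<close> makes the normalising
  constant of the original model larger, which gives the Gaussian factor.\<close>

lemma regular_weight_le:
  fixes a :: "'a \<Rightarrow> real" and \<theta> :: real
  assumes "finite S" and a: "\<And>i. i \<in> S \<Longrightarrow> \<bar>a i\<bar> \<le> arsinh 1" and \<theta>: "\<bar>\<theta>\<bar> \<le> arsinh 1"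
  defines "x \<equiv> exp (2 * \<theta>)" and "m \<equiv> card S"
  assumes b: "\<And>i j. real (i choose j) * x^j \<le> (1 + x)^i * \<beta> i"
    and tilt: "\<And>i. i \<in> S \<Longrightarrow> (real d - x / (1 + x) * (real m - 1)) * (a i - \<theta>) \<le> 0"
  shows "(\<Sum>H\<in>with_degrees S (\<lambda>_. d). \<Prod>e\<in>H. exp (\<Sum>i\<in>e. a i)) / (\<Prod>e\<in>pairs S. 1 + exp (\<Sum>i\<in>e. a i))
     \<le> (\<Prod>i<m. \<beta> i) * (\<Prod>i\<in>S. exp (- ((real m - 2) / 16 * (a i - \<theta>)\<^sup>2)))"
proof -
  define D where "D = (\<Sum>i\<in>S. a i - \<theta>)"
  define D2 where "D2 = (\<Sum>i\<in>S. (a i - \<theta>)\<^sup>2)"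
  define p where "p = x / (1 + x)"
  define q where "q e = p * (\<Sum>i\<in>e. a i - \<theta>) + (\<Sum>i\<in>e. a i - \<theta>)\<^sup>2 / 16" for e
  define M where "M = (1 + x)^(m choose 2)"
  have x: "x > 0" by (simp add: x_def)
  have M: "M > 0" using x by (simp add: M_def)
  have "0 \<le> \<beta> i" for i
  proof -
    have "0 < (1 + x)^i * \<beta> i" using b[of i 0] by simp
    then show ?thesis using x by (simp add: zero_less_mult_iff)
  qed
  then have \<beta>: "(\<Prod>i<m. \<beta> i) \<ge> 0" by (intro prod_nonneg) auto
  have w: "(\<Prod>e\<in>H. exp (\<Sum>i\<in>e. a i)) = exp (real d * D) * x^card H" if H: "H \<in> with_degrees S (\<lambda>_. d)" for H
  proof -
    have HS: "H \<subseteq> pairs S" and deg: "\<And>v. v \<in> S \<Longrightarrow> degree_in H v = d"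
      using H by (auto simp: with_degrees_def)
    have fH: "finite H" using HS assms(1) finite_subset finite_pairs by blast
    have "(\<Sum>e\<in>H. \<Sum>i\<in>e. a i) = (\<Sum>v\<in>S. a v * real d)"
      unfolding sum_edges_vertices[OF assms(1) HS] using deg by simp
    also have "\<dots> = real d * D + (\<Sum>v\<in>S. \<theta> * real d)"
      by (simp add: D_def sum_subtractf sum_distrib_left algebra_simps)
    also have "(\<Sum>v\<in>S. \<theta> * real d) = (\<Sum>e\<in>H. \<Sum>i\<in>e. \<theta>)"
      unfolding sum_edges_vertices[OF assms(1) HS] using deg by simp
    also have "\<dots> = (\<Sum>e\<in>H. 2 * \<theta>)"
      using HS by (intro sum.cong) (auto simp: pairs_def)
    finally have "(\<Sum>e\<in>H. \<Sum>i\<in>e. a i) = real d * D + real (card H) * (2 * \<theta>)" by simp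
    then show ?thesis
      using fH by (simp add: exp_sum[symmetric] exp_add x_def exp_of_nat_mult)
  qed
  have "(\<Sum>H\<in>with_degrees S (\<lambda>_. d). \<Prod>e\<in>H. exp (\<Sum>i\<in>e. a i)) =
      exp (real d * D) * (\<Sum>H\<in>with_degrees S (\<lambda>_. d). x^card H)"
    by (simp add: w sum_distrib_left)
  also have "\<dots> \<le> exp (real d * D) * (\<Prod>i<m. (1 + x)^i * \<beta> i)"
    unfolding m_def using x b by (intro mult_left_mono sum_with_degrees_le assms(1)) auto
  also have "(\<Prod>i<m. (1 + x)^i * \<beta> i) = M * (\<Prod>i<m. \<beta> i)"
    by (simp add: prod.distrib prod_powers_eq_choose_two M_def)
  finally have num: "(\<Sum>H\<in>with_degrees S (\<lambda>_. d). \<Prod>e\<in>H. exp (\<Sum>i\<in>e. a i)) \<le>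
      exp (real d * D) * (M * (\<Prod>i<m. \<beta> i))" .
  \<comment> \<open>All edges use the tangent at the same point \<open>2 * \<theta>\<close>, hence
    with the same slope \<open>p\<close>; this lets the linear terms add up to a multiple of
    \<open>D\<close>.\<close>
  have "(\<Prod>e\<in>pairs S. (1 + x) * exp (q e)) \<le> (\<Prod>e\<in>pairs S. 1 + exp (\<Sum>i\<in>e. a i))"
  proof (intro prod_mono conjI)
    fix e assume e: "e \<in> pairs S"
    then have e2: "e \<subseteq> S" "card e = 2" by (auto simp: pairs_def)
    have "\<bar>\<Sum>i\<in>e. a i\<bar> \<le> (\<Sum>i\<in>e. arsinh 1)"
      using e2 a by (intro order.trans[OF sum_abs] sum_mono) auto
    then have "\<bar>\<Sum>i\<in>e. a i\<bar> \<le> 2 * arsinh 1" using e2 by simp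
    moreover have "\<bar>2 * \<theta>\<bar> \<le> 2 * arsinh 1" using \<theta> by simp
    moreover have "(\<Sum>i\<in>e. a i - \<theta>) = (\<Sum>i\<in>e. a i) - 2 * \<theta>" using e2 by (simp add: sum_subtractf)
    ultimately show "(1 + x) * exp (q e) \<le> 1 + exp (\<Sum>i\<in>e. a i)"
      using one_plus_exp_above_gaussian_tangent[of "\<Sum>i\<in>e. a i" "2 * \<theta>"]
      by (simp add: q_def p_def x_def)
    show "0 \<le> (1 + x) * exp (q e)" using x by simp
  qed
  moreover have "(\<Prod>e\<in>pairs S. (1 + x) * exp (q e)) = M * exp (\<Sum>e\<in>pairs S. q e)"
    using assms(1) by (simp add: prod.distrib exp_sum card_pairs M_def m_def)
  moreover have "(\<Sum>e\<in>pairs S. q e) = p * ((real m - 1) * D) + ((real m - 2) * D2 + D\<^sup>2) / 16"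
    unfolding q_def m_def D_def D2_def
    by (simp only: sum.distrib sum_distrib_left[symmetric] sum_divide_distrib[symmetric]
        sum_pairs_vertices[OF assms(1)] sum_pairs_square[OF assms(1)])
  ultimately have den: "M * exp (p * ((real m - 1) * D) + ((real m - 2) * D2 + D\<^sup>2) / 16) \<le>
      (\<Prod>e\<in>pairs S. 1 + exp (\<Sum>i\<in>e. a i))"
    by simp
  \<comment> \<open>\<open>p * (m - 1)\<close> is the expected degree in the constant model. The
    linear terms combine to its difference from \<open>d\<close>, times \<open>D\<close>, and the
    tilt makes each summand nonpositive. The term \<open>D\<^sup>2 / 16\<close> has a helpful sign
    and is dropped.\<close>
  have "(real d - p * (real m - 1)) * D = (\<Sum>i\<in>S. (real d - p * (real m - 1)) * (a i - \<theta>))"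
    by (simp add: D_def sum_distrib_left)
  also have "\<dots> \<le> 0" using tilt by (intro sum_nonpos) (simp add: p_def)
  finally have "(real d - p * (real m - 1)) * D \<le> 0" .
  moreover have "D\<^sup>2 \<ge> 0" by simp
  moreover have "real d * D - p * ((real m - 1) * D) = (real d - p * (real m - 1)) * D"
    by (simp add: algebra_simps)
  moreover have "((real m - 2) * D2 + D\<^sup>2) / 16 = (real m - 2) / 16 * D2 + D\<^sup>2 / 16"
    by (simp add: add_divide_distrib)
  ultimately have neg: "real d * D - (p * ((real m - 1) * D) + ((real m - 2) * D2 + D\<^sup>2) / 16) \<le>
      - ((real m - 2) / 16 * D2)"
    by linarith
  have "(\<Sum>H\<in>with_degrees S (\<lambda>_. d). \<Prod>e\<in>H. exp (\<Sum>i\<in>e. a i)) / (\<Prod>e\<in>pairs S. 1 + exp (\<Sum>i\<in>e. a i))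
     \<le> (exp (real d * D) * (M * (\<Prod>i<m. \<beta> i))) / (M * exp (p * ((real m - 1) * D) + ((real m - 2) * D2 +
         D\<^sup>2) / 16))"
    using num den M \<beta> by (intro frac_le) auto
  also have "\<dots> = (\<Prod>i<m. \<beta> i) * exp (real d * D - (p * ((real m - 1) * D) + ((real m - 2) * D2 +
      D\<^sup>2) / 16))"
    using M by (simp add: exp_diff)
  also have "\<dots> \<le> (\<Prod>i<m. \<beta> i) * exp (- ((real m - 2) / 16 * D2))"
    using neg \<beta> by (intro mult_left_mono) auto
  also have "exp (- ((real m - 2) / 16 * D2)) = (\<Prod>i\<in>S. exp (- ((real m - 2) / 16 * (a i - \<theta>)\<^sup>2)))"
    using assms(1) by (simp add: exp_sum[symmetric] D2_def sum_distrib_left sum_negf)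
  finally show ?thesis .
qed

text \<open>The ideal \<open>\<theta>\<close> makes the expected degree equal to \<open>D\<close>; if it lies outside \<open>[-A, A]\<close>, the nearer
  endpoint has the right sign.\<close>

lemma exists_tilt:
  fixes A D M :: real
  assumes "A \<ge> 0"
  obtains \<theta> where "\<bar>\<theta>\<bar> \<le> A"
    "\<And>z. \<bar>z\<bar> \<le> A \<Longrightarrow> (D - exp (2 * \<theta>) / (1 + exp (2 * \<theta>)) * M) * (z - \<theta>) \<le> 0"
proof -
  define f where "f t = D - exp (2 * t) / (1 + exp (2 * t)) * M" for t :: real
  have cont: "continuous_on {-A..A} f"
  proof -
    have "1 + exp (2 * t) \<noteq> 0" for t :: real by (metis add_pos_pos exp_gt_zero less_numeral_extra(1,3))
    then show ?thesis unfolding f_def by (intro continuous_intros) auto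
  qed
  consider "f A \<ge> 0" | "f (-A) \<le> 0" | "f A < 0" "f (-A) > 0" by linarith
  then show ?thesis
  proof cases
    case 1
    then have "f A * (z - A) \<le> 0" if "\<bar>z\<bar> \<le> A" for z
      using that by (intro mult_nonneg_nonpos) auto
    then show ?thesis using that[of A] assms by (auto simp: f_def)
  next
    case 2
    then have "f (-A) * (z - (-A)) \<le> 0" if "\<bar>z\<bar> \<le> A" for z
      using that by (intro mult_nonpos_nonneg) auto
    then show ?thesis using that[of "-A"] assms by (auto simp: f_def)
  next
    case 3
    obtain t where "-A \<le> t" "t \<le> A" "f t = 0"
      using IVT2'[of f A 0 "-A"] 3 assms cont by auto
    then show ?thesis using that[of t] by (auto simp: f_def)
  qed
qed

text \<open>Dividing by \<open>(1 + x)^i\<close> with \<open>x = exp (2 * \<theta>)\<close> turns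
  the left side into a binomial probability for \<open>p = x / (1 + x)\<close>, where
  \<open>p * (1 - p) = 1 / (4 * cosh \<theta> ^ 2)\<close>. This doubles 102/100 and produces
  \<open>cosh \<theta>\<close>. Below \<open>i0\<close> the trivial bound 1 is used.\<close>

lemma binomial_weight_bound:
  "\<exists>i0\<ge>1. \<forall>\<theta>::real. \<bar>\<theta>\<bar> \<le> arsinh 1 \<longrightarrow> (\<forall>i j. real (i choose j) * exp (2 * \<theta>)^j \<le>
      (1 + exp (2 * \<theta>))^i * (if i < i0 then 1 else (204/100 / sqrt (2 * pi) * cosh \<theta>) / sqrt (real i)))"
proof -
  obtain i0 where i0: "i0 \<ge> 1" "\<And>i x p. i \<ge> i0 \<Longrightarrow> x \<le> i \<Longrightarrow> 0 < p \<Longrightarrow> p < 1 \<Longrightarrow> 1/8 \<le> p * (1 - p) \<Longrightarrow>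
     Bernstein i x p \<le> 102/100 / sqrt (2 * pi * real i * (p * (1 - p)))"
    using Bernstein_le_eventually by blast
  have "real (i choose j) * exp (2 * \<theta>)^j \<le>
      (1 + exp (2 * \<theta>))^i * (if i < i0 then 1 else (204/100 / sqrt (2 * pi) *
          cosh \<theta>) / sqrt (real i))" (is "_ \<le> _ * ?B")
    if \<theta>: "\<bar>\<theta>\<bar> \<le> arsinh 1" for \<theta> :: real and i j
  proof (cases "j \<le> i")
    case True
    define x where "x = exp (2 * \<theta>)"
    define p where "p = x / (1 + x)"
    have x: "x > 0" by (simp add: x_def)
    have p: "0 < p" "p < 1" "1 - p = 1 / (1 + x)" using x by (auto simp: p_def field_simps)
    have pq: "p * (1 - p) = 1 / (4 * cosh \<theta> ^ 2)"
      using logistic_variance[of "2 * \<theta>"] by (simp add: p(3)) (simp add: p_def x_def power2_eq_square)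
    have ch: "cosh \<theta> ^ 2 \<le> 2" "cosh \<theta> > 0" using cosh_square_le_two[OF \<theta>] by auto
    then have p8: "1/8 \<le> p * (1 - p)" unfolding pq by (simp add: field_simps)
    have "Bernstein i j p \<le> ?B"
    proof (cases "i < i0")
      case True
      have "Bernstein i j p \<le> (\<Sum>k\<le>i. Bernstein i k p)"
        using \<open>j \<le> i\<close> p by (intro member_le_sum) (auto simp: Bernstein_nonneg)
      then show ?thesis using True by simp
    next
      case False
      have "Bernstein i j p \<le> 102/100 / sqrt (2 * pi * real i * (p * (1 - p)))"
        using False i0(2)[of i j p] \<open>j \<le> i\<close> p p8 by simp
      also have "sqrt (2 * pi * real i * (p * (1 - p))) = sqrt (2 * pi) * sqrt (real i) / (2 * cosh \<theta>)"
      proof -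
        have "2 * pi * real i * (p * (1 - p)) = 2 * pi * real i / (2 * cosh \<theta>)^2"
          unfolding pq by (simp add: power2_eq_square)
        then show ?thesis using ch
          by (simp only: real_sqrt_divide real_sqrt_mult real_sqrt_abs)
      qed
      finally show ?thesis using False by (simp add: field_simps)
    qed
    moreover have "(1 + x)^i * Bernstein i j p = real (i choose j) * x^j"
    proof -
      have "(1 + x)^i = (1 + x)^j * (1 + x)^(i - j)" using True by (simp add: power_add[symmetric])
      then show ?thesis using x
        unfolding Bernstein_def p(3) by (simp add: p_def power_divide)
    qed
    moreover have "(1 + x)^i \<ge> 0" using x by simp
    ultimately show ?thesis unfolding x_def by (metis mult_left_mono)
  next
    case False
    then have z: "i choose j = 0" by simp
    show ?thesis unfolding z by (auto intro!: mult_nonneg_nonneg divide_nonneg_nonneg add_nonneg_nonneg)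
  qed
  then show ?thesis using i0(1) by blast
qed

text \<open>Using 1 for the first \<open>i0\<close> factors costs only a constant that does not
  depend on \<open>m\<close> or \<open>\<kappa>\<close>: since \<open>\<kappa> \<ge> 1/2\<close>,
  the power \<open>2^i0\<close> pays for the missing \<open>\<kappa>^i0\<close>. The factor
  \<open>sqrt m\<close> appears because the product stops at \<open>m - 1\<close>.\<close>

lemma prod_eventually_sqrt_le:
  fixes \<kappa> :: real
  assumes "i0 \<ge> 1" "\<kappa> \<ge> 1/2" "m \<ge> i0"
  shows "(\<Prod>i<m. if i < i0 then 1 else \<kappa> / sqrt (real i)) \<le>
      2^i0 * sqrt (fact i0) * (\<kappa>^m * sqrt (real m) / sqrt (fact m))"
  using assms(3)
proof (induction rule: dec_induct)
  case base
  have "1 \<le> (2 * \<kappa>)^i0" using assms by (intro one_le_power) simp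
  moreover have "1 \<le> sqrt (real i0)" using assms by simp
  ultimately have "1 * 1 \<le> (2 * \<kappa>)^i0 * sqrt (real i0)" by (intro mult_mono) auto
  then show ?case by (simp add: power_mult_distrib)
next
  case (step m)
  have m: "real m > 0" using step assms by simp
  have "(\<Prod>i<Suc m. if i < i0 then 1 else \<kappa> / sqrt (real i)) =
      (\<Prod>i<m. if i < i0 then 1 else \<kappa> / sqrt (real i)) * (\<kappa> / sqrt (real m))"
    using step by simp
  also have "\<dots> \<le> (2^i0 * sqrt (fact i0) * (\<kappa>^m * sqrt (real m) / sqrt (fact m))) * (\<kappa> / sqrt (real m))"
    using step assms by (intro mult_right_mono) auto
  also have "\<dots> = 2^i0 * sqrt (fact i0) * (\<kappa>^Suc m * (sqrt (real (Suc m)) / (sqrt (real (Suc m)) *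
      sqrt (fact m))))"
    using m by (simp del: of_nat_Suc)
  also have "sqrt (real (Suc m)) * sqrt (fact m) = sqrt (fact (Suc m))"
    by (simp only: real_sqrt_mult[symmetric] fact_Suc of_nat_mult)
  finally show ?case by (simp only: times_divide_eq_right)
qed

text \<open>Limit of the base of the \<open>m\<close>-th power. Without the slack factors 102/100
  and \<open>exp (1/100)\<close> it equals \<open>72 * sqrt 2 * exp (3/2) / (163 * pi)\<close>, so
  this is where 9/163 has to be small enough.\<close>

lemma limit_constant_bound:
  "204/100 / sqrt (2 * pi) * (18/163 / pi * (exp (1/100) * sqrt (16 * pi))) * (exp 1 *
      sqrt (exp 1)) < 93/100"
proof -
  have e: "exp 1 \<le> (27183/10000 :: real)" using abs_le_D1[OF e_approx_32] by simp
  have se: "sqrt (exp 1) \<le> (16488/10000 :: real)"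
    by (rule order.trans[OF real_sqrt_le_mono[OF e]], rule real_le_lsqrt) (auto simp: power2_eq_square)
  have s2: "sqrt 2 \<le> (14143/10000 :: real)" by (rule real_le_lsqrt) (auto simp: power2_eq_square)
  have "exp (- (1/100)) \<ge> 1 + (- (1/100 :: real))" by (rule exp_ge_add_one_self)
  then have ee: "exp (1/100) \<le> (100/99 :: real)" by (simp add: exp_minus field_simps)
  have pi: "pi \<ge> 31415/10000" using pi_approx by simp
  have "204/100 / sqrt (2 * pi) * (18/163 / pi * (exp (1/100) * sqrt (16 * pi))) * (exp 1 * sqrt (exp 1))
     = (204/100 * 18/163 * 4 / sqrt 2) / pi * exp (1/100) * (exp 1 * sqrt (exp 1))"
    by (simp add: real_sqrt_mult field_simps)
  also have "(204/100 * 18/163 * 4 / sqrt 2) = 204/100 * 36/163 * (sqrt 2)"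
    by (simp add: field_simps)
  also have "204/100 * 36/163 * (sqrt 2) / pi * exp (1/100) * (exp 1 * sqrt (exp 1)) \<le>
     204/100 * 36/163 * (14143/10000) / (31415/10000) * (100/99) * (27183/10000 * (16488/10000))"
    using e se s2 ee pi by (intro mult_mono frac_le) (auto intro!: mult_nonneg_nonneg)
  also have "\<dots> < 93/100" by simp
  finally show ?thesis .
qed

text \<open>The main term has order \<open>m^2 / sqrt m\<close>, which balances the denominator of
  order \<open>m powr (3/2)\<close>; this balance is the source of the quadratic growth. The
  remaining terms vanish in the limit.\<close>

lemma gaussian_bound_eventually:
  "\<forall>\<^sub>F m::nat in sequentially. 
     204/100 / sqrt (2 * pi) * (2 * (9/163 * real m^2 * exp (- ((real m - 2) / 16 * (1/100)\<^sup>2)) + 2)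
       + 18/163 * real m^2 / pi * (exp (1/100) * sqrt (pi / ((real m - 2) / 16))))
       / (real m / exp 1 * sqrt (real m / exp 1)) \<le> 94/100"
proof -
  define c where "c = 204/100 / sqrt (2 * pi)"
  define E where "E = exp (1::real)"
  define s where "s = sqrt E"
  define g where "g = exp (1/100::real)"
  define P where "P = sqrt (16 * pi)"
  have pos: "c > 0" "E > 0" "s > 0" "g > 0" "P > 0" by (auto simp: c_def E_def s_def g_def P_def)
  have lim: "(\<lambda>m::nat. c * (2 * (9/163 * real m^2 * exp (- ((real m - 2) / 16 * (1/100)\<^sup>2)) + 2)
       + 18/163 * real m^2 / pi * (g * (P / sqrt (real m - 2))))
       / (real m / E * (sqrt (real m) / s))) \<longlonglongrightarrow> c * (18 * inverse pi * (g * P)) * (E * s) / 163"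
    using pos pi_gt_zero by real_asymp
  have "c * (18 * inverse pi * (g * P)) * (E * s) / 163 = c * (18/163 / pi * (g * P)) * (E * s)"
    by (simp add: field_simps)
  also have "\<dots> < 94/100"
    using limit_constant_bound unfolding c_def g_def P_def E_def s_def by linarith
  finally have lt: "c * (18 * inverse pi * (g * P)) * (E * s) / 163 < 94/100" .
  have eq: "sqrt (pi / ((real m - 2) / 16)) = P / sqrt (real m - 2)" for m
    by (simp add: P_def real_sqrt_divide[symmetric] mult.commute)
  have sq: "sqrt (real m / exp 1) = sqrt (real m) / s" for m
    by (simp add: s_def E_def real_sqrt_divide)
  show ?thesis
    using order_tendstoD(2)[OF lim lt]
  proof eventually_elim
    case (elim m)
    from less_imp_le[OF elim] show ?case by (simp only: eq sq c_def g_def E_def)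
  qed
qed


section \<open>The first moment bound\<close>

text \<open>The probability that \<open>S\<close> induces a \<open>d\<close>-regular subgraph when the edges \<open>{i, j}\<close> are independent
  with odds \<open>exp (a\<^sub>i + a\<^sub>j)\<close>, \<open>a = vertex_weight n\<close>.\<close>

definition regular_prob :: "nat \<Rightarrow> nat \<Rightarrow> nat set \<Rightarrow> real" where
  "regular_prob n d S =
     (\<Sum>H\<in>with_degrees S (\<lambda>_. d). \<Prod>e\<in>H. exp (\<Sum>i\<in>e. vertex_weight n i)) /
     (\<Prod>e\<in>pairs S. 1 + exp (\<Sum>i\<in>e. vertex_weight n i))"

lemma power_le_fact: "(real m / exp 1)^m \<le> fact m"
proof (cases "m = 0")
  case False
  have "1 * 1 \<le> 2 * pi * real m" using False pi_ge_two by (intro mult_mono) auto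
  then have "1 * (real m / exp 1)^m \<le> sqrt (2 * pi * real m) * (real m / exp 1)^m"
    by (intro mult_right_mono) auto
  also have "\<dots> \<le> fact m" using stirling_lower[of m] False by simp
  finally show ?thesis by simp
qed simp

text \<open>One \<open>fact m\<close> comes from summing over unordered sets and another
  \<open>sqrt (fact m)\<close> from the product of binomial bounds. Replacing \<open>fact m\<close>
  by \<open>(m / exp 1)^m\<close> puts everything under a single \<open>m\<close>-th power, apart
  from the factor \<open>C * sqrt m\<close>.\<close>

lemma sum_regular_prob_le:
  "\<exists>C>0. \<exists>m0. \<forall>m\<ge>m0. \<forall>n\<ge>1. \<forall>d. real n \<le> 9/163 * real m^2 \<longrightarrow>
     (\<Sum>S | S \<subseteq> {..<n} \<and> card S = m. regular_prob n d S) \<le> C * sqrt (real m) * (94/100)^m"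
proof -
  obtain i0 where i0: "i0 \<ge> 1" "\<And>(\<theta>::real) i j. \<bar>\<theta>\<bar> \<le> arsinh 1 \<Longrightarrow> real (i choose j) * exp (2 * \<theta>)^j \<le>
      (1 + exp (2 * \<theta>))^i * (if i < i0 then 1 else (204/100 / sqrt (2 * pi) * cosh \<theta>) / sqrt (real i))"
    using binomial_weight_bound by blast
  obtain m1 :: nat where m1: "\<And>m. m \<ge> m1 \<Longrightarrow>
     204/100 / sqrt (2 * pi) * (2 * (9/163 * real m^2 * exp (- ((real m - 2) / 16 * (1/100)\<^sup>2)) + 2)
       + 18/163 * real m^2 / pi * (exp (1/100) * sqrt (pi / ((real m - 2) / 16))))
       / (real m / exp 1 * sqrt (real m / exp 1)) \<le> 94/100"
    using gaussian_bound_eventually unfolding eventually_sequentially by blast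
  define C :: real where "C = 2^i0 * sqrt (fact i0)"
  have C: "C > 0" by (simp add: C_def)
  have "(\<Sum>S | S \<subseteq> {..<n} \<and> card S = m. regular_prob n d S) \<le> C * sqrt (real m) * (94/100)^m"
    if m: "m \<ge> max (max i0 3) m1" and n: "n \<ge> 1" "real n \<le> 9/163 * real m^2" for m n d
  proof -
    define c where "c = 204/100 / sqrt (2 * pi)"
    have "arsinh 0 \<le> arsinh (1::real)" by (metis arsinh_less_iff_real not_le zero_less_one less_imp_le)
    then have A0: "arsinh (1::real) \<ge> 0" by simp
    \<comment> \<open>The tilt depends on \<open>d\<close> and \<open>m\<close> but not on
      \<open>S\<close>, so the Gaussian factors of all sets \<open>S\<close> share one
      centre.\<close>
    obtain \<theta> where \<theta>: "\<bar>\<theta>\<bar> \<le> arsinh 1"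
      "\<And>z. \<bar>z\<bar> \<le> arsinh 1 \<Longrightarrow> (real d - exp (2 * \<theta>) / (1 + exp (2 * \<theta>)) * (real m - 1)) * (z - \<theta>) \<le> 0"
      using exists_tilt[OF A0, of "real d" "real m - 1"] by blast
    define \<kappa> where "\<kappa> = c * cosh \<theta>"
    define \<beta> where "\<beta> i = (if i < i0 then 1 else \<kappa> / sqrt (real i))" for i :: nat
    define B where "B = (\<Prod>i<m. \<beta> i)"
    define l where "l = (real m - 2) / 16"
    define G where "G = (\<Sum>i<n. exp (- (l * (vertex_weight n i - \<theta>)\<^sup>2)))"
    have "sqrt (2 * pi) \<le> 4" using pi_less_4 by (intro real_le_lsqrt) auto
    then have "204/100 / 4 \<le> c" unfolding c_def by (intro divide_left_mono) auto
    then have c: "c \<ge> 1/2" by simp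
    have "1/2 * 1 \<le> \<kappa>"
      unfolding \<kappa>_def using c cosh_real_ge_1[of \<theta>] by (intro mult_mono) auto
    then have \<kappa>: "\<kappa> \<ge> 1/2" by simp
    have ch: "cosh \<theta> \<le> 2"
      by (rule power2_le_imp_le) (use cosh_square_le_two[OF \<theta>(1)] in auto)
    have l: "l > 0" using m by (simp add: l_def)
    have G0: "G \<ge> 0" by (auto simp: G_def intro: sum_nonneg)
    have B0: "B \<ge> 0" unfolding B_def \<beta>_def using \<kappa> by (intro prod_nonneg) auto
    have "(\<Sum>S | S \<subseteq> {..<n} \<and> card S = m. regular_prob n d S)
        \<le> (\<Sum>S | S \<subseteq> {..<n} \<and> card S = m. B * (\<Prod>i\<in>S. exp (- (l * (vertex_weight n i - \<theta>)\<^sup>2))))"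
    proof (rule sum_mono)
      fix S assume "S \<in> {S. S \<subseteq> {..<n} \<and> card S = m}"
      then have S: "S \<subseteq> {..<n}" "card S = m" by auto
      have fS: "finite S" using S finite_subset by blast
      have aS: "\<bar>vertex_weight n i\<bar> \<le> arsinh 1" if "i \<in> S" for i
        using that S by (intro abs_vertex_weight_le) auto
      show "regular_prob n d S \<le> B * (\<Prod>i\<in>S. exp (- (l * (vertex_weight n i - \<theta>)\<^sup>2)))"
        using regular_weight_le[OF fS aS \<theta>(1), where \<beta> = \<beta> and d = d] i0(2)[OF \<theta>(1)] \<theta>(2)[OF aS]
        unfolding regular_prob_def B_def l_def S(2) \<beta>_def \<kappa>_def c_def by simp
    qed
    also have "\<dots> = B * (\<Sum>S | S \<subseteq> {..<n} \<and> card S = m. \<Prod>i\<in>S. exp (- (l * (vertex_weight n i - \<theta>)\<^sup>2)))"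
      by (simp add: sum_distrib_left)
    also have "\<dots> \<le> B * (G^m / fact m)"
      unfolding G_def using B0 by (intro mult_left_mono sum_prod_subsets_le) auto
    also have "\<dots> \<le> (C * (\<kappa>^m * sqrt (real m) / sqrt (fact m))) * (G^m / fact m)"
      unfolding B_def \<beta>_def C_def using m i0(1) \<kappa> G0
      by (intro mult_right_mono prod_eventually_sqrt_le) auto
    also have "\<dots> = C * sqrt (real m) * ((\<kappa> * G)^m / (fact m * sqrt (fact m)))"
      by (simp add: power_mult_distrib mult_ac)
    also have "\<dots> \<le> C * sqrt (real m) * ((\<kappa> * G)^m / ((real m / exp 1)^m * sqrt ((real m / exp 1)^m)))"
      using C \<kappa> G0 m power_le_fact[of m]
      by (intro mult_left_mono divide_left_mono mult_mono real_sqrt_le_mono) auto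
    also have "(\<kappa> * G)^m / ((real m / exp 1)^m * sqrt ((real m / exp 1)^m)) =
        (\<kappa> * G / (real m / exp 1 * sqrt (real m / exp 1)))^m"
      by (simp only: real_sqrt_power power_divide[of "\<kappa> * G"] power_mult_distrib[of "real m / exp 1"])
    also have "C * sqrt (real m) * \<dots> \<le> C * sqrt (real m) * (94/100)^m"
    proof (intro mult_left_mono power_mono)
      have "G \<le> real n * exp (- (l * (1/100)\<^sup>2)) + 2 +
          2 * real n / pi * (exp (1/100) / cosh \<theta>) * sqrt (pi / l)"
        unfolding G_def using n l by (intro sum_gaussian_vertex_weight_le) auto
      then have "\<kappa> * G \<le> \<kappa> * (real n * exp (- (l * (1/100)\<^sup>2)) + 2 +
          2 * real n / pi * (exp (1/100) / cosh \<theta>) * sqrt (pi / l))"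
        using \<kappa> by (intro mult_left_mono) auto
      also have "\<dots> = c * (cosh \<theta> * (real n * exp (- (l * (1/100)\<^sup>2)) + 2) +
          2 * real n / pi * (exp (1/100) * sqrt (pi / l)))"
        by (simp add: \<kappa>_def distrib_left)
      \<comment> \<open>In the main term \<open>cosh \<theta>\<close> has cancelled; in the
        lower-order terms the crude bound \<open>cosh \<theta> \<le> 2\<close> is enough.\<close>
      also have "\<dots> \<le> c * (2 * (9/163 * real m^2 * exp (- (l * (1/100)\<^sup>2)) + 2) +
          2 * (9/163 * real m^2) / pi * (exp (1/100) * sqrt (pi / l)))"
        using c ch n l by (intro mult_left_mono add_mono mult_mono divide_right_mono) auto
      finally have "\<kappa> * G / (real m / exp 1 * sqrt (real m / exp 1)) \<le>
         c * (2 * (9/163 * real m^2 * exp (- (l * (1/100)\<^sup>2)) + 2) +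
             2 * (9/163 * real m^2) / pi * (exp (1/100) * sqrt (pi / l)))
          / (real m / exp 1 * sqrt (real m / exp 1))"
        by (intro divide_right_mono) auto
      also have "\<dots> \<le> 94/100" using m1[of m] m by (simp add: c_def l_def)
      finally show "\<kappa> * G / (real m / exp 1 * sqrt (real m / exp 1)) \<le> 94/100" .
    qed (use C \<kappa> G0 in auto)
    finally show ?thesis .
  qed
  then show ?thesis using C by blast
qed

text \<open>Union bound over all sizes \<open>m\<close> from \<open>k\<close> to \<open>n\<close>,
  all degrees and all \<open>m\<close>-sets. The hypothesis on \<open>n\<close> passes from
  \<open>k\<close> to every larger \<open>m\<close>, and the \<open>m + 1\<close> degrees and the
  factor \<open>C * sqrt m\<close> are absorbed by enlarging 94/100 to 95/100.\<close>

lemma exists_graph_without_large_regular: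
  "\<exists>k0. \<forall>k\<ge>k0. \<forall>n\<ge>1. real n \<le> 9/163 * real k^2 \<longrightarrow>
     (\<exists>F\<subseteq>pairs {..<n}. \<forall>S\<subseteq>{..<n}. k \<le> card S \<longrightarrow> (\<forall>d\<le>card S. F \<inter> pairs S \<notin> with_degrees S (\<lambda>_. d)))"
proof -
  obtain C m0 where C: "C > 0" and m0: "\<And>m n d. m \<ge> m0 \<Longrightarrow> n \<ge> 1 \<Longrightarrow> real n \<le> 9/163 * real m^2 \<Longrightarrow>
     (\<Sum>S | S \<subseteq> {..<n} \<and> card S = m. regular_prob n d S) \<le> C * sqrt (real m) * (94/100)^m"
    using sum_regular_prob_le by blast
  have "\<forall>\<^sub>F m::nat in sequentially. (real m + 1) * (C * sqrt (real m) * (94/100)^m) \<le> (95/100)^m"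
    using C by real_asymp
  moreover have "\<forall>\<^sub>F m::nat in sequentially. 20 * (95/100)^m < (1::real)" by real_asymp
  ultimately have "\<forall>\<^sub>F m::nat in sequentially. m \<ge> m0 \<and> (real m + 1) * (C * sqrt (real m) * (94/100)^m) \<le>
      (95/100)^m
      \<and> 20 * (95/100)^m < (1::real)"
    using eventually_ge_at_top[of m0] by eventually_elim simp
  then obtain k0 where k0: "\<And>m. m \<ge> k0 \<Longrightarrow> m \<ge> m0 \<and> (real m + 1) * (C * sqrt (real m) * (94/100)^m) \<le>
      (95/100)^m
      \<and> 20 * (95/100)^m < (1::real)"
    by (auto simp: eventually_sequentially)
  have "\<exists>F\<subseteq>pairs {..<n}. \<forall>S\<subseteq>{..<n}. k \<le> card S \<longrightarrow> (\<forall>d\<le>card S. F \<inter> pairs S \<notin> with_degrees S (\<lambda>_. d))"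
    if k: "k \<ge> k0" and n: "n \<ge> 1" "real n \<le> 9/163 * real k^2" for k n
  proof -
    define I where "I = Sigma {k..n} (\<lambda>m. {..m} \<times> {S. S \<subseteq> {..<n} \<and> card S = m})"
    have bound: "(\<Sum>d\<le>m. \<Sum>S | S \<subseteq> {..<n} \<and> card S = m. regular_prob n d S) \<le> (95/100)^m"
      if "m \<in> {k..n}" for m
    proof -
      have mk: "k \<le> m" "m \<ge> k0" using that k by auto
      have "real k^2 \<le> real m^2" using mk by simp
      then have nm: "real n \<le> 9/163 * real m^2" using n(2) by linarith
      have "(\<Sum>d\<le>m. \<Sum>S | S \<subseteq> {..<n} \<and> card S = m. regular_prob n d S) \<le>
          (\<Sum>d\<le>m. C * sqrt (real m) * (94/100)^m)"
        using mk k0 n(1) nm by (intro sum_mono m0) auto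
      also have "\<dots> = (real m + 1) * (C * sqrt (real m) * (94/100)^m)" by simp
      also have "\<dots> \<le> (95/100)^m" using k0[OF mk(2)] by simp
      finally show ?thesis .
    qed
    have fI: "finite I" unfolding I_def by (intro finite_SigmaI finite_cartesian_product) auto
    have "(\<Sum>(m, d, S)\<in>I. regular_prob n d S) = (\<Sum>m\<in>{k..n}. \<Sum>d\<le>m. \<Sum>S | S \<subseteq> {..<n} \<and> card S =
        m. regular_prob n d S)"
      unfolding I_def by (subst sum.Sigma[symmetric]) (auto simp: sum.cartesian_product)
    also have "\<dots> \<le> (\<Sum>m\<in>{k..n}. (95/100)^m)" by (intro sum_mono bound)
    \<comment> \<open>Geometric series, with \<open>20 = 1 / (1 - 95/100)\<close>.\<close>
    also have "\<dots> \<le> 20 * (95/100)^k" by (simp add: sum_gp)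
    also have "\<dots> < 1" using k0[OF k] by simp
    finally have less: "(\<Sum>(m, d, S)\<in>I. regular_prob n d S) < 1" .
    define w where "w e = exp (\<Sum>i\<in>e. vertex_weight n i)" for e
    have "\<exists>F\<subseteq>pairs {..<n}. \<forall>q\<in>I. F \<inter> pairs (snd (snd q)) \<notin> with_degrees (snd (snd q)) (\<lambda>_. fst (snd q))"
    proof (rule exists_avoiding_events[where w = w])
      show "(\<Sum>q\<in>I. (\<Sum>H\<in>with_degrees (snd (snd q)) (\<lambda>_. fst (snd q)). \<Prod>e\<in>H. w e) / (\<Prod>e\<in>pairs (snd (snd q)).
          1 + w e)) < 1"
        using less by (simp add: regular_prob_def w_def split_def)
    qed (use fI in \<open>auto simp: w_def I_def with_degrees_def intro!: pairs_mono\<close>)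
    then obtain F where F: "F \<subseteq> pairs {..<n}"
      "\<forall>q\<in>I. F \<inter> pairs (snd (snd q)) \<notin> with_degrees (snd (snd q)) (\<lambda>_. fst (snd q))"
      by (elim exE conjE)
    have "F \<inter> pairs S \<notin> with_degrees S (\<lambda>_. d)" if "S \<subseteq> {..<n}" "k \<le> card S" "d \<le> card S" for S d
    proof -
      have "card S \<le> n" using card_mono[OF _ that(1)] by simp
      then have "(card S, d, S) \<in> I" using that by (simp add: I_def)
      from bspec[OF F(2) this] show ?thesis by simp
    qed
    then show ?thesis using F(1) by (intro exI[of _ F]) simp
  qed
  then show ?thesis by (intro exI[of _ k0]) simp
qed

section \<open>Passage from edge sets to adjacency relations and \<open>N_ge\<close>\<close>

lemma degree_in_induced:
  assumes "F \<subseteq> pairs V" "S \<subseteq> V" "v \<in> S"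
  shows "degree_in (F \<inter> pairs S) v = card {u \<in> S. {v, u} \<in> F}"
proof -
  have nv: "{v} \<notin> F" using assms(1) by (auto simp: pairs_def)
  have "{e \<in> F \<inter> pairs S. v \<in> e} = (\<lambda>u. {v, u}) ` {u \<in> S. {v, u} \<in> F}"
  proof (intro equalityI subsetI)
    fix e assume e: "e \<in> {e \<in> F \<inter> pairs S. v \<in> e}"
    then obtain x y where "e = {x, y}" "x \<noteq> y" by (auto simp: pairs_def card_2_iff)
    then show "e \<in> (\<lambda>u. {v, u}) ` {u \<in> S. {v, u} \<in> F}"
      using e by (auto simp: pairs_def insert_commute)
  next
    fix e assume "e \<in> (\<lambda>u. {v, u}) ` {u \<in> S. {v, u} \<in> F}"
    then show "e \<in> {e \<in> F \<inter> pairs S. v \<in> e}"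
      using assms nv by (auto simp: pairs_def card_2_iff)
  qed
  moreover have "inj_on (\<lambda>u. {v, u}) {u \<in> S. {v, u} \<in> F}"
    using nv by (auto simp: inj_on_def doubleton_eq_iff)
  ultimately show ?thesis by (simp add: degree_in_def card_image)
qed

text \<open>Guarantees that the \<open>LEAST\<close> in \<open>N_ge\<close> is attained. By Ramsey's
  theorem there is a clique or an independent set of order \<open>k\<close>, and both are
  regular.\<close>

lemma exists_order_with_large_regular:
  "\<exists>n\<ge>1. \<forall>E :: nat \<Rightarrow> nat \<Rightarrow> bool. simple_graph {0..<n} E \<longrightarrow>
     (\<exists>S\<subseteq>{0..<n}. induced_regular E S \<and> card S \<ge> k)"
proof -
  obtain r :: nat where r: "r \<ge> 1" "\<And>(V::nat set) E. finite V \<Longrightarrow> card V \<ge> r \<Longrightarrow>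
    (\<exists>R \<subseteq> V. card R = k \<and> clique R E \<or> card R = k \<and> indep R E)"
    using ramsey2[of k k] by blast
  have "\<exists>S\<subseteq>{0..<r}. induced_regular E S \<and> card S \<ge> k" if E: "simple_graph {0..<r} E"
      for E :: "nat \<Rightarrow> nat \<Rightarrow> bool"
  proof -
    define X where "X = {{u, v} |u v. u < r \<and> v < r \<and> E u v}"
    have X: "{u, v} \<in> X \<longleftrightarrow> E u v" if "u < r" "v < r" for u v
      using that E by (auto simp: X_def simple_graph_def doubleton_eq_iff)
    obtain R where R: "R \<subseteq> {0..<r}" "card R = k" "clique R X \<or> indep R X"
      using r(2)[of "{0..<r}" X] by auto
    have irr: "\<not> E v v" if "v \<in> R" for v using that R(1) E by (auto simp: simple_graph_def)
    have lt: "v < r" if "v \<in> R" for v using that R(1) by auto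
    from R(3) have "induced_regular E R"
    proof
      assume "clique R X"
      then have "{u \<in> R. E v u} = R - {v}" if "v \<in> R" for v
        using that irr X lt by (auto simp: clique_def)
      then show ?thesis using R(1) finite_subset[of R] by (auto simp: induced_regular_def)
    next
      assume "indep R X"
      then have "\<not> E v u" if "v \<in> R" "u \<in> R" for v u
        using that irr X lt unfolding indep_def by (cases "u = v") auto
      then have "{u \<in> R. E v u} = {}" if "v \<in> R" for v using that by simp
      then have "card {u \<in> R. E v u} = 0" if "v \<in> R" for v using that by (simp only: card.empty)
      then show ?thesis unfolding induced_regular_def by (intro exI[of _ 0] ballI)
    qed
    with R show ?thesis by blast
  qed
  with r(1) show ?thesis by blast
qed

theorem theorem1:
  shows "\<exists>k0::nat. \<forall>k::nat. k \<ge> k0 \<longrightarrow> real (N_ge k) \<ge> 9 / 163 * (real k)^2"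
proof -
  obtain k0 where k0: "\<forall>k\<ge>k0. \<forall>n\<ge>1. real n \<le> 9/163 * real k^2 \<longrightarrow>
     (\<exists>F\<subseteq>pairs {..<n}. \<forall>S\<subseteq>{..<n}. k \<le> card S \<longrightarrow> (\<forall>d\<le>card S. F \<inter> pairs S \<notin> with_degrees S (\<lambda>_. d)))"
    using exists_graph_without_large_regular by (elim exE)
  have "real (N_ge k) \<ge> 9 / 163 * (real k)^2" if k: "k \<ge> k0" for k
  proof (rule ccontr)
    assume less: "\<not> ?thesis"
    define n where "n = N_ge k"
    have n: "n \<ge> 1" "\<And>E :: nat \<Rightarrow> nat \<Rightarrow> bool. simple_graph {0..<n} E \<Longrightarrow>
        \<exists>S\<subseteq>{0..<n}. induced_regular E S \<and> card S \<ge> k"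
      using LeastI_ex[OF exists_order_with_large_regular[of k]] unfolding n_def N_ge_def by blast+
    have "real n \<le> 9/163 * real k^2" using less by (simp add: n_def)
    from k0[rule_format, OF k n(1) this] obtain F where F: "F \<subseteq> pairs {..<n}"
      "\<forall>S\<subseteq>{..<n}. k \<le> card S \<longrightarrow> (\<forall>d\<le>card S. F \<inter> pairs S \<notin> with_degrees S (\<lambda>_. d))"
      by (elim exE conjE)
    have "simple_graph {0..<n} (\<lambda>u v. {u, v} \<in> F)"
      using F(1) by (auto simp: simple_graph_def pairs_def insert_commute)
    from n(2)[OF this] obtain S d where S: "S \<subseteq> {..<n}" "k \<le> card S"
      and d: "\<And>v. v \<in> S \<Longrightarrow> card {u \<in> S. {v, u} \<in> F} = d"
      by (auto simp: induced_regular_def lessThan_atLeast0)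
    \<comment> \<open>For empty \<open>S\<close> the obtained \<open>d\<close> is arbitrary, so it
      is capped to meet the range \<open>d \<le> card S\<close>; for nonempty \<open>S\<close> the
      cap changes nothing.\<close>
    define d' where "d' = min d (card S)"
    have fS: "finite S" using S finite_subset by blast
    have "degree_in (F \<inter> pairs S) v = d'" if "v \<in> S" for v
    proof -
      have "card {u \<in> S. {v, u} \<in> F} \<le> card S" by (intro card_mono fS) auto
      then show ?thesis using degree_in_induced[OF F(1) S(1) that] d[OF that] by (simp add: d'_def)
    qed
    then have "F \<inter> pairs S \<in> with_degrees S (\<lambda>_. d')" by (auto simp: with_degrees_def)
    moreover have "d' \<le> card S" by (simp add: d'_def)
    ultimately show False using F(2)[rule_format, OF S] by simp
  qed
  then show ?thesis by blast
qed

end
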